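(* Disconnected Cut is $O(n^4)$-time solvable for line graphs of $n$-vertex graphs.
   Context: A disconnected cut of a connected graph $G$ is a vertex set $U$ such that $G-U$ is disconnected and $G[U]$ is disconnected; equivalently $V(G)$ can be partitioned into nonempty sets $V_1,V_2,V_3,V_4$ with $V_1$ anticomplete to $V_3$ and $V_2$ anticomplete to $V_4$. The Disconnected Cut problem asks whether a given connected graph has a disconnected cut. The line graph $L(G)$ of a graph $G$ has the edges of $G$ as vertices, two being adjacent if they share an endpoint; the input is $L(G)$ where $G$ has $n$ vertices. *)

theory Defs
  imports "HOL-Library.Landau_Symbols" "Graph_Theory.Graph_Theory"
begin

section \<open>Graphs and disconnected cuts\<close>

text \<open>
  A finite simple graph is a \<^locale>\<open>pair_graph\<close>: a finite symmetric loop-free digraph whose arcs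
  are pairs of vertices. The undirected edge between \<open>u\<close> and \<open>v\<close> is the set \<open>{u, v}\<close>, which stands
  for the two arcs \<open>(u, v)\<close> and \<open>(v, u)\<close>.
\<close>

definition edges :: "'a pair_pre_digraph \<Rightarrow> 'a set set" where
  "edges G = {{u, v} | u v. (u, v) \<in> parcs G}"

definition line_graph :: "'a pair_pre_digraph \<Rightarrow> 'a set pair_pre_digraph" where
  "line_graph G = \<lparr> pverts = edges G,
     parcs = {(e, f). e \<in> edges G \<and> f \<in> edges G \<and> e \<noteq> f \<and> e \<inter> f \<noteq> {}} \<rparr>"

text \<open>
  The library predicate \<open>connected\<close> is false for the graph without vertices. That graph is not
  disconnected either: a disconnected graph has at least two components.
\<close>

definition disconnected :: "('a, 'b) pre_digraph \<Rightarrow> bool" where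
  "disconnected G \<longleftrightarrow> verts G \<noteq> {} \<and> \<not> Digraph_Component.connected G"

definition disconnected_cut :: "('a, 'b) pre_digraph \<Rightarrow> 'a set \<Rightarrow> bool" where
  "disconnected_cut G U \<longleftrightarrow>
     U \<subseteq> verts G \<and> disconnected (G \<restriction> (verts G - U)) \<and> disconnected (G \<restriction> U)"

definition has_disconnected_cut :: "('a, 'b) pre_digraph \<Rightarrow> bool" where
  "has_disconnected_cut G \<longleftrightarrow> (\<exists>U. disconnected_cut G U)"

lemma pair_graph_line_graph:
  assumes "pair_graph G"
  shows "pair_graph (line_graph G)"
proof -
  interpret pair_graph G by (fact assms)
  have "edges G \<subseteq> (\<lambda>(u, v). {u, v}) ` parcs G"
    by (force simp: edges_def)
  then have fin: "finite (edges G)"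
    using pair_finite_arcs finite_surj by blast
  have "finite (parcs (line_graph G))"
    by (rule finite_subset[of _ "edges G \<times> edges G"]) (auto simp: line_graph_def fin)
  moreover have "sym (parcs (line_graph G))"
    by (auto simp: line_graph_def sym_def)
  ultimately show ?thesis
    by unfold_locales (auto simp: line_graph_def fin symmetric_def)
qed

lemma disconnected_induced_iff:
  fixes G :: "'a pair_pre_digraph"
  assumes sym: "sym (parcs G)"
  shows "disconnected (with_proj G \<restriction> U) \<longleftrightarrow>
    (\<exists>A B. A \<noteq> {} \<and> B \<noteq> {} \<and> A \<inter> B = {} \<and> A \<union> B = U \<and> A \<times> B \<inter> parcs G = {})"
  (is "?L \<longleftrightarrow> ?R")
proof -
  define R where "R = {(x, y) \<in> parcs G. x \<in> U \<and> y \<in> U}"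
  have mk: "mk_symmetric (with_proj G \<restriction> U) = \<lparr> pverts = U, parcs = R \<rparr>"
    using sym by (force simp: mk_symmetric_def induce_subgraph_def R_def sym_def)
  have L: "?L \<longleftrightarrow> U \<noteq> {} \<and> (\<exists>u\<in>U. \<exists>v\<in>U. (u, v) \<notin> rtrancl_on U R)"
    by (auto simp: disconnected_def Digraph_Component.connected_def mk strongly_connected_def
        reachable_def)
  show ?thesis
  proof
    assume ?L
    then obtain u v where uv: "u \<in> U" "v \<in> U" "(u, v) \<notin> rtrancl_on U R"
      using L by auto
    define A where "A = {x \<in> U. (u, x) \<in> rtrancl_on U R}"
    have "u \<in> A" "v \<in> U - A"
      using uv by (auto simp: A_def)
    moreover have "A \<times> (U - A) \<inter> parcs G = {}"
      by (auto simp: A_def R_def intro: rtrancl_on_into_rtrancl_on)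
    moreover have "A \<subseteq> U"
      by (auto simp: A_def)
    ultimately show ?R
      by (metis Diff_disjoint Un_Diff_cancel Un_absorb1 empty_iff)
  next
    assume ?R
    then obtain A B a b where AB: "a \<in> A" "b \<in> B" "A \<inter> B = {}" "A \<union> B = U"
      "A \<times> B \<inter> parcs G = {}" by auto
    have "x \<in> A" if "(a, x) \<in> rtrancl_on U R" for x
      using that
    proof (induction rule: rtrancl_on_induct)
      case base
      show ?case by (fact AB(1))
    next
      case (step y z)
      then show ?case using AB by (auto simp: R_def)
    qed
    then have "(a, b) \<notin> rtrancl_on U R"
      using AB by auto
    then show ?L
      using L AB by auto
  qed
qed

lemma has_disconnected_cut_iff_partition:
  assumes "pair_graph G"
  shows "has_disconnected_cut (with_proj G) \<longleftrightarrow>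
    (\<exists>V1 V2 V3 V4. V1 \<noteq> {} \<and> V2 \<noteq> {} \<and> V3 \<noteq> {} \<and> V4 \<noteq> {} \<and>
      V1 \<inter> V2 = {} \<and> V1 \<inter> V3 = {} \<and> V1 \<inter> V4 = {} \<and> V2 \<inter> V3 = {} \<and> V2 \<inter> V4 = {} \<and> V3 \<inter> V4 = {} \<and>
      V1 \<union> V2 \<union> V3 \<union> V4 = pverts G \<and> V1 \<times> V3 \<inter> parcs G = {} \<and> V2 \<times> V4 \<inter> parcs G = {})"
  (is "?L \<longleftrightarrow> ?R")
proof -
  interpret pair_graph G by (fact assms)
  have sym: "sym (parcs G)"
    using pair_sym_arcs by (simp add: symmetric_def)
  show ?thesis
  proof
    assume ?L
    then obtain U where "U \<subseteq> pverts G" "disconnected (with_proj G \<restriction> (pverts G - U))"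
      "disconnected (with_proj G \<restriction> U)"
      by (auto simp: has_disconnected_cut_def disconnected_cut_def)
    moreover from this(2) obtain V1 V3 where
      "V1 \<noteq> {}" "V3 \<noteq> {}" "V1 \<inter> V3 = {}" "V1 \<union> V3 = pverts G - U" "V1 \<times> V3 \<inter> parcs G = {}"
      unfolding disconnected_induced_iff[OF sym] by (elim exE conjE) (rule that)
    moreover from calculation(3) obtain V2 V4 where
      "V2 \<noteq> {}" "V4 \<noteq> {}" "V2 \<inter> V4 = {}" "V2 \<union> V4 = U" "V2 \<times> V4 \<inter> parcs G = {}"
      unfolding disconnected_induced_iff[OF sym] by (elim exE conjE) (rule that)
    moreover have "V1 \<union> V2 \<union> V3 \<union> V4 = (V1 \<union> V3) \<union> (V2 \<union> V4)"
      by auto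
    ultimately have "V1 \<inter> V2 = {}" "V1 \<inter> V4 = {}" "V2 \<inter> V3 = {}" "V3 \<inter> V4 = {}"
      "V1 \<union> V2 \<union> V3 \<union> V4 = pverts G" by blast+
    then show ?R
      using \<open>V1 \<noteq> {}\<close> \<open>V2 \<noteq> {}\<close> \<open>V3 \<noteq> {}\<close> \<open>V4 \<noteq> {}\<close> \<open>V1 \<inter> V3 = {}\<close> \<open>V2 \<inter> V4 = {}\<close>
        \<open>V1 \<times> V3 \<inter> parcs G = {}\<close> \<open>V2 \<times> V4 \<inter> parcs G = {}\<close>
      by (intro exI conjI)
  next
    assume ?R
    then obtain V1 V2 V3 V4 where
      ne: "V1 \<noteq> {}" "V2 \<noteq> {}" "V3 \<noteq> {}" "V4 \<noteq> {}" and
      dj: "V1 \<inter> V2 = {}" "V1 \<inter> V3 = {}" "V1 \<inter> V4 = {}" "V2 \<inter> V3 = {}" "V2 \<inter> V4 = {}"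
        "V3 \<inter> V4 = {}" and
      un: "V1 \<union> V2 \<union> V3 \<union> V4 = pverts G" and
      ac: "V1 \<times> V3 \<inter> parcs G = {}" "V2 \<times> V4 \<inter> parcs G = {}"
      by (elim exE conjE) (rule that)
    have "V1 \<union> V3 = pverts G - (V2 \<union> V4)"
      using dj un by auto
    then have "disconnected (with_proj G \<restriction> (pverts G - (V2 \<union> V4)))"
      unfolding disconnected_induced_iff[OF sym]
      using ne dj ac by metis
    moreover have "disconnected (with_proj G \<restriction> (V2 \<union> V4))"
      unfolding disconnected_induced_iff[OF sym]
      using ne dj ac by metis
    ultimately have "disconnected_cut (with_proj G) (V2 \<union> V4)"
      using un by (auto simp: disconnected_cut_def)
    then show ?L
      by (auto simp: has_disconnected_cut_def)
  qed
qed


section \<open>Running time\<close>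

text \<open>
  Algorithms are structured programs for a word RAM with \<open>w\<close>-bit words. A program uses finitely
  many named registers and finitely many named arrays. An array has \<open>2 ^ w\<close> cells, since every
  computed index is a word. Reading a register or an array cell, an arithmetic operation, a
  comparison, an assignment and a branch each cost one time unit. Addition and multiplication are
  modulo \<open>2 ^ w\<close>; subtraction is truncated at \<open>0\<close>; a comparison yields \<open>0\<close> or \<open>1\<close>.
\<close>

datatype exp =
    Num nat
  | Var string
  | Cell string exp
  | Plus exp exp
  | Minus exp exp
  | Times exp exp
  | Less exp exp

datatype com =
    Skip
  | Assign string exp
  | Store string exp exp
  | Seq com com
  | Cond exp com com
  | While exp com

record store =
  var :: "string \<Rightarrow> nat"
  cell :: "string \<Rightarrow> nat \<Rightarrow> nat"

fun eval :: "nat \<Rightarrow> store \<Rightarrow> exp \<Rightarrow> nat" where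
  "eval w s (Num k) = k mod 2 ^ w"
| "eval w s (Var x) = var s x"
| "eval w s (Cell a i) = cell s a (eval w s i)"
| "eval w s (Plus a b) = (eval w s a + eval w s b) mod 2 ^ w"
| "eval w s (Minus a b) = eval w s a - eval w s b"
| "eval w s (Times a b) = (eval w s a * eval w s b) mod 2 ^ w"
| "eval w s (Less a b) = of_bool (eval w s a < eval w s b)"

fun cost :: "exp \<Rightarrow> nat" where
  "cost (Num k) = 1"
| "cost (Var x) = 1"
| "cost (Cell a i) = 1 + cost i"
| "cost (Plus a b) = 1 + cost a + cost b"
| "cost (Minus a b) = 1 + cost a + cost b"
| "cost (Times a b) = 1 + cost a + cost b"
| "cost (Less a b) = 1 + cost a + cost b"

text \<open>
  \<open>run w P s t s'\<close>: with word length \<open>w\<close>, program \<open>P\<close> started in store \<open>s\<close> terminates in store \<open>s'\<close>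
  after \<open>t\<close> time units. Nonzero values count as true.
\<close>

inductive run :: "nat \<Rightarrow> com \<Rightarrow> store \<Rightarrow> nat \<Rightarrow> store \<Rightarrow> bool" for w :: nat where
  run_Skip: "run w Skip s 1 s"
| run_Assign: "run w (Assign x e) s (1 + cost e) (s\<lparr>var := (var s)(x := eval w s e)\<rparr>)"
| run_Store: "run w (Store a i e) s (1 + cost i + cost e)
    (s\<lparr>cell := (cell s)(a := (cell s a)(eval w s i := eval w s e))\<rparr>)"
| run_Seq: "run w P s t1 s1 \<Longrightarrow> run w Q s1 t2 s2 \<Longrightarrow> run w (Seq P Q) s (t1 + t2) s2"
| run_Cond_True: "eval w s e \<noteq> 0 \<Longrightarrow> run w P s t s' \<Longrightarrow> run w (Cond e P Q) s (1 + cost e + t) s'"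
| run_Cond_False: "eval w s e = 0 \<Longrightarrow> run w Q s t s' \<Longrightarrow> run w (Cond e P Q) s (1 + cost e + t) s'"
| run_While_True: "eval w s e \<noteq> 0 \<Longrightarrow> run w P s t1 s1 \<Longrightarrow> run w (While e P) s1 t2 s2 \<Longrightarrow>
    run w (While e P) s (1 + cost e + t1 + t2) s2"
| run_While_False: "eval w s e = 0 \<Longrightarrow> run w (While e P) s (1 + cost e) s"

inductive_cases run_SkipE: "run w Skip s t s'"
  and run_AssignE: "run w (Assign x e) s t s'"
  and run_StoreE: "run w (Store a i e) s t s'"
  and run_SeqE: "run w (Seq P Q) s t s'"
  and run_CondE: "run w (Cond e P Q) s t s'"
  and run_WhileE: "run w (While e P) s t s'"

lemma run_deterministic:
  assumes "run w P s t s'" and "run w P s u s''"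
  shows "u = t \<and> s'' = s'"
  using assms
proof (induction arbitrary: u s'' rule: run.induct)
  case (run_Seq P s t1 s1 Q t2 s2)
  from run_Seq.prems obtain u1 r u2 where "run w P s u1 r" "run w Q r u2 s''" "u = u1 + u2"
    by (elim run_SeqE) (rule that)
  with run_Seq.IH show ?case by blast
next
  case (run_While_True s e P t1 s1 t2 s2)
  obtain u1 r u2 where
    "run w P s u1 r" "run w (While e P) r u2 s''" "u = 1 + cost e + u1 + u2"
    by (rule run_WhileE[OF run_While_True.prems]) (use run_While_True.hyps(1) in auto)
  with run_While_True.IH show ?case by blast
next
  case (run_Skip s)
  then show ?case by (elim run_SkipE) simp
next
  case (run_Assign x e s)
  then show ?case by (elim run_AssignE) simp
next
  case (run_Store a i e s)
  then show ?case by (elim run_StoreE) simp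
next
  case (run_Cond_True s e P t s' Q)
  from run_Cond_True.prems run_Cond_True.hyps obtain v where "run w P s v s''" "u = 1 + cost e + v"
    by (elim run_CondE) auto
  with run_Cond_True.IH show ?case by blast
next
  case (run_Cond_False s e Q t s' P)
  from run_Cond_False.prems run_Cond_False.hyps obtain v where "run w Q s v s''" "u = 1 + cost e + v"
    by (elim run_CondE) auto
  with run_Cond_False.IH show ?case by blast
next
  case (run_While_False s e P)
  from run_While_False.prems show ?case
    by (rule run_WhileE) (use run_While_False.hyps in auto)
qed

text \<open>
  The input is a graph with vertices \<open>0, \<dots>, N - 1\<close>. The program receives \<open>N\<close> in register \<open>size\<close> and
  the adjacency matrix, stored row by row, in array \<open>adj\<close>; everything else is \<open>0\<close>.
\<close>

definition input :: "nat pair_pre_digraph \<Rightarrow> store" where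
  "input H = (let N = card (pverts H) in
     \<lparr> var = (\<lambda>_. 0)(''size'' := N),
       cell = (\<lambda>_ _. 0)(''adj'' :=
         (\<lambda>k. of_bool (k < N * N \<and> (k div N, k mod N) \<in> parcs H))) \<rparr>)"

definition answers_within :: "nat \<Rightarrow> com \<Rightarrow> nat pair_pre_digraph \<Rightarrow> bool \<Rightarrow> nat \<Rightarrow> bool" where
  "answers_within w P H b T \<longleftrightarrow>
     (\<exists>t s. run w P (input H) t s \<and> t \<le> T \<and> var s ''out'' = of_bool b)"

text \<open>
  \<open>P\<close> has to work for every word length \<open>w\<close> of at least \<open>d * log 2 (N + 1)\<close> bits, where \<open>N\<close> is the
  number of vertices of the input graph \<open>H\<close> and \<open>d\<close> may depend on \<open>P\<close> only. The program sees \<open>H\<close>,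
  but neither a root graph \<open>G\<close> nor the number of vertices of \<open>G\<close>. Root graphs have natural
  numbers as vertices, which is no restriction for finite graphs and keeps \<open>P\<close> independent of a
  vertex type.
\<close>

definition solves_disconnected_cut_on_line_graphs :: "com \<Rightarrow> nat \<Rightarrow> (nat \<Rightarrow> nat) \<Rightarrow> bool" where
  "solves_disconnected_cut_on_line_graphs P d T \<longleftrightarrow>
     (\<forall>(G :: nat pair_pre_digraph) (H :: nat pair_pre_digraph) n N w.
        pair_graph G \<and> card (pverts G) = n \<and>
        pverts H = {..<N} \<and> digraph_iso (with_proj (line_graph G)) (with_proj H) \<and>
        Digraph_Component.connected (with_proj H) \<and>
        (N + 1) ^ d \<le> 2 ^ w
        \<longrightarrow> answers_within w P H (has_disconnected_cut (with_proj H)) (T n))"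

end

theory Submission
  imports Defs
begin

text \<open>
  A connected line graph \<open>H\<close> has a disconnected cut iff it has diameter at least \<open>3\<close> or a
  non-dominating vertex whose neighbourhood induces a disconnected graph. Both conditions are
  sufficient in every connected graph. Conversely, let \<open>H = L(G)\<close> have diameter at most \<open>2\<close>, i.e.
  any two disjoint edges of \<open>G\<close> are joined by an edge. A partition of \<open>V(H) = E(G)\<close> witnessing a
  disconnected cut is a colouring of \<open>E(G)\<close> by \<open>1, 2, 3, 4\<close> in which no vertex of \<open>G\<close> sees both
  \<open>1\<close> and \<open>3\<close> or both \<open>2\<close> and \<open>4\<close>. So the vertices of \<open>G\<close> fall into the four classes \<open>12\<close>, \<open>23\<close>,
  \<open>34\<close>, \<open>41\<close>; opposite classes are anticomplete, hence cannot both contain an edge, and two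
  consecutive classes are independent. Between these two classes there is then an edge \<open>cd\<close> of \<open>G\<close>
  that lies in no triangle, has further edges at both ends and is disjoint from some edge. In
  \<open>L(G)\<close> the neighbourhood of \<open>cd\<close> consists of two nonempty anticomplete cliques, and \<open>cd\<close> is not
  dominating.

  Vertices of \<open>L(G)\<close> have degree at most \<open>2n\<close>, so visiting all pairs of neighbours of each of the
  at most \<open>n\<^sup>2\<close> vertices takes time \<open>O(n\<^sup>4)\<close> and suffices to test both conditions.
\<close>

section \<open>Disconnected cuts of line graphs\<close>

text \<open>
  The classes are encoded by two predicates on the vertices of the root graph: \<open>p\<close> separates colour
  \<open>1\<close> from \<open>3\<close>, and \<open>q\<close> separates \<open>2\<close> from \<open>4\<close>. By symmetry the two independent classes are those
  outside \<open>q\<close>.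
\<close>

lemma labelled_edge:
  fixes adj :: "'a \<Rightarrow> 'a \<Rightarrow> bool"
  assumes sym: "\<And>x y. adj x y \<Longrightarrow> adj y x"
    and lab: "\<And>x y. adj x y \<Longrightarrow> p x = p y \<or> q x = q y"
    and ind: "\<And>x y. adj x y \<Longrightarrow> \<not> q x \<Longrightarrow> \<not> q y \<Longrightarrow> p x \<noteq> p y"
    and join: "\<And>x y u v. adj x y \<Longrightarrow> adj u v \<Longrightarrow> {x, y} \<inter> {u, v} = {} \<Longrightarrow>
      adj x u \<or> adj x v \<or> adj y u \<or> adj y v"
    and e1: "adj x1 y1" "p x1" "p y1"
    and e2: "adj x2 y2" "q x2" "q y2"
    and e3: "adj x3 y3" "\<not> p x3" "\<not> p y3"
    and e4: "adj x4 y4" "\<not> q x4" "\<not> q y4"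
  shows "\<exists>c d a b x y. adj c d \<and> adj a d \<and> a \<noteq> c \<and> adj b c \<and> b \<noteq> d \<and>
    adj x y \<and> {x, y} \<inter> {c, d} = {} \<and> (\<forall>z. \<not> (adj c z \<and> adj d z))"
proof -
  \<comment> \<open>The target configuration: \<open>c\<close> in class \<open>34\<close> and
    \<open>d\<close> in class \<open>41\<close>, each with a neighbour inside \<open>q\<close>. The
    edge \<open>x2 y2\<close> lies inside \<open>q\<close>, so it is disjoint from
    \<open>cd\<close>.\<close>
  have found: ?thesis
    if "adj c d" "\<not> q c" "\<not> q d" "\<not> p c" "p d" "adj a d" "q a" "adj b c" "q b" for c d a b
  proof -
    \<comment> \<open>A common neighbour \<open>z\<close> outside \<open>q\<close> would need
      \<open>p z\<close> by \<open>ind\<close> against \<open>c\<close> and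
      \<open>\<not> p z\<close> by \<open>ind\<close> against \<open>d\<close>. Inside
      \<open>q\<close>, \<open>lab\<close> gives the same contradiction with the two roles
      swapped.\<close>
    have "\<not> (adj c z \<and> adj d z)" for z
      using that lab[of c z] lab[of d z] ind[of c z] ind[of d z] by blast
    then show ?thesis
      using that e2 by (intro exI[of _ c] exI[of _ d] exI[of _ a] exI[of _ b] exI[of _ x2]
          exI[of _ y2]) auto
  qed
  obtain c d where cd: "adj c d" "\<not> q c" "\<not> q d" "\<not> p c" "p d"
    using ind[OF e4] e4 sym by metis
  have "{x1, y1} \<inter> {x3, y3} = {}"
    using e1 e3 by auto
  \<comment> \<open>The edges \<open>x1 y1\<close> and \<open>x3 y3\<close> lie on different sides
    of \<open>p\<close>, so \<open>join\<close> yields an edge \<open>xy\<close> crossing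
    \<open>p\<close>; \<open>x'\<close> and \<open>y'\<close> are their remaining ends. By
    \<open>lab\<close> the ends of \<open>xy\<close> agree on \<open>q\<close>, hence the two
    cases.\<close>
  then obtain x x' y y' where xy: "adj x y" "adj x x'" "adj y y'" "p x" "p x'" "\<not> p y" "\<not> p y'"
    using join[OF e1(1) e3(1)] e1 e3 sym by metis
  show ?thesis
  proof (cases "q x")
    case False
    moreover have "\<not> q y"
      using False lab[OF xy(1)] xy by auto
    \<comment> \<open>Here \<open>xy\<close> itself joins the two independent classes, and
      \<open>ind\<close> puts \<open>x'\<close> and \<open>y'\<close> inside
      \<open>q\<close>.\<close>
    ultimately show ?thesis
      using found[of y x x' y'] xy sym ind by metis
  next
    case q: True
    have "q y"
      using q lab[OF xy(1)] xy by auto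
    have "{x, y} \<inter> {c, d} = {}"
      using q \<open>q y\<close> cd by auto
    \<comment> \<open>The other two connections, \<open>xc\<close> and \<open>yd\<close>, would join
      opposite classes.\<close>
    then consider "adj x d" | "adj y c"
      using join[OF xy(1) cd(1)] lab[of x c] lab[of y d] xy cd q \<open>q y\<close> by auto
    then show ?thesis
    proof cases
      case 1
      \<comment> \<open>The end \<open>d\<close> already has the neighbour \<open>x\<close> in
        \<open>q\<close>. Joining \<open>y y'\<close> to \<open>cd\<close> makes \<open>y\<close> or
        \<open>y'\<close> such a neighbour of \<open>c\<close>, unless \<open>y'\<close> is adjacent
        to \<open>d\<close>; then the edge \<open>y'd\<close> replaces \<open>cd\<close>.\<close>
      show ?thesis
      proof (cases "y' = c")
        case True
        then show ?thesis
          using found[of c d x y] 1 cd xy q \<open>q y\<close> by blast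
      next
        case False
        then have "{y, y'} \<inter> {c, d} = {}"
          using cd xy \<open>q y\<close> by auto
        then consider "adj y c" | "adj y' c" | "adj y' d"
          using join[OF xy(3) cd(1)] lab[of y d] xy cd \<open>q y\<close> by auto
        then show ?thesis
          using found[of c d x y] found[of c d x y'] found[of y' d x y] lab[of y' d] ind[of y' c]
            1 cd xy q \<open>q y\<close> by cases blast+
      qed
    next
      case 2
      \<comment> \<open>Mirror image of the previous case with \<open>p\<close> negated; the
        replacing edge is now \<open>cx'\<close>.\<close>
      show ?thesis
      proof (cases "x' = d")
        case True
        then show ?thesis
          using found[of c d x y] 2 cd xy q \<open>q y\<close> by blast
      next
        case False
        then have "{x, x'} \<inter> {c, d} = {}"
          using cd xy q by auto
        then consider "adj x d" | "adj x' d" | "adj x' c"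
          using join[OF xy(2) cd(1)] lab[of x c] xy cd q by auto
        then show ?thesis
          using found[of c d x y] found[of c d x' y] found[of c x' x y] lab[of x' c] ind[of x' d]
            2 cd xy q \<open>q y\<close> sym by cases blast+
      qed
    qed
  qed
qed

text \<open>
  In a line graph the neighbourhood of \<open>g\<close> is covered by two cliques. If it is disconnected, they
  are its components, so it can be split along the closed neighbourhood of any neighbour \<open>f\<close>.
\<close>

definition locally_split :: "'a set \<Rightarrow> ('a \<Rightarrow> 'a \<Rightarrow> bool) \<Rightarrow> 'a \<Rightarrow> 'a \<Rightarrow> bool" where
  "locally_split V R g f \<longleftrightarrow>
     (\<exists>h\<in>V. h \<noteq> g \<and> \<not> R g h) \<and> (\<exists>j\<in>V. R g j \<and> j \<noteq> f \<and> \<not> R f j) \<and>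
     (\<forall>i\<in>V. \<forall>j\<in>V. R g i \<longrightarrow> R g j \<longrightarrow> i = f \<or> R f i \<longrightarrow> j \<noteq> f \<longrightarrow> \<not> R f j \<longrightarrow> \<not> R i j)"

text \<open>For symmetric \<open>R\<close>, distance at least 3. The common neighbour
  \<open>g\<close> comes first because the program enumerates pairs from their middle
  vertex.\<close>

definition far_apart :: "'a set \<Rightarrow> ('a \<Rightarrow> 'a \<Rightarrow> bool) \<Rightarrow> 'a \<Rightarrow> 'a \<Rightarrow> bool" where
  "far_apart V R a b \<longleftrightarrow> a \<noteq> b \<and> \<not> R a b \<and> \<not> (\<exists>g\<in>V. R g a \<and> R g b)"

text \<open>For symmetric \<open>R\<close>, a vertex-surjective homomorphism to the 4-cycle with a
  loop at every vertex.\<close>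

definition C4_partition :: "'a set \<Rightarrow> ('a \<Rightarrow> 'a \<Rightarrow> bool) \<Rightarrow> bool" where
  "C4_partition V R \<longleftrightarrow> (\<exists>V1 V2 V3 V4. V1 \<noteq> {} \<and> V2 \<noteq> {} \<and> V3 \<noteq> {} \<and> V4 \<noteq> {} \<and>
      V1 \<inter> V2 = {} \<and> V1 \<inter> V3 = {} \<and> V1 \<inter> V4 = {} \<and> V2 \<inter> V3 = {} \<and> V2 \<inter> V4 = {} \<and> V3 \<inter> V4 = {} \<and>
      V1 \<union> V2 \<union> V3 \<union> V4 = V \<and> (\<forall>x\<in>V1. \<forall>y\<in>V3. \<not> R x y) \<and> (\<forall>x\<in>V2. \<forall>y\<in>V4. \<not> R x y))"

section \<open>Sufficiency of the two conditions\<close>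

lemma C4_partitionI:
  assumes "V1 \<noteq> {}" "V2 \<noteq> {}" "V3 \<noteq> {}" "V4 \<noteq> {}"
    and "V1 \<inter> V2 = {}" "V1 \<inter> V3 = {}" "V1 \<inter> V4 = {}" "V2 \<inter> V3 = {}" "V2 \<inter> V4 = {}" "V3 \<inter> V4 = {}"
    and "V1 \<union> V2 \<union> V3 \<union> V4 = V"
    and "\<And>x y. x \<in> V1 \<Longrightarrow> y \<in> V3 \<Longrightarrow> \<not> R x y" "\<And>x y. x \<in> V2 \<Longrightarrow> y \<in> V4 \<Longrightarrow> \<not> R x y"
  shows "C4_partition V R"
  unfolding C4_partition_def
  by (rule exI[of _ V1], rule exI[of _ V2], rule exI[of _ V3], rule exI[of _ V4])
    (intro conjI ballI assms)

text \<open>The neighbourhood of \<open>a\<close> avoids \<open>b\<close> and its neighbours' role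
  is safe at distance 3: no neighbour of \<open>a\<close> is adjacent to \<open>b\<close>. So
  \<open>{a}\<close> is paired with the remaining vertices and the neighbourhood of \<open>a\<close>
  with \<open>{b}\<close>; a neighbour of \<open>b\<close> keeps the remainder nonempty.\<close>

lemma C4_partition_if_far_apart:
  assumes sym: "\<And>x y. R x y \<Longrightarrow> R y x" and inV: "\<And>x y. R x y \<Longrightarrow> x \<in> V \<and> y \<in> V"
    and irr: "\<And>x. \<not> R x x"
    and nbr: "\<And>x. x \<in> V \<Longrightarrow> \<exists>y. R x y"
    and a: "a \<in> V" and b: "b \<in> V" and far: "far_apart V R a b"
  shows "C4_partition V R"
proof -
  obtain a' b' where a': "R a a'" and b': "R b b'"
    using nbr a b by blast
  have far': "a \<noteq> b" "\<not> R a b" "\<And>g. R a g \<Longrightarrow> \<not> R g b"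
    using far sym inV unfolding far_apart_def by blast+
  have "b' \<in> V - {a, b} - Collect (R a)"
    using b' far' sym inV irr by blast
  then show ?thesis
    using a a' b far' inV irr
    by (intro C4_partitionI[of "{a}" "Collect (R a)" "V - {a, b} - Collect (R a)" "{b}"]) blast+
qed

text \<open>The cut set is the neighbourhood of \<open>g\<close>, split along \<open>S\<close>;
  outside it, \<open>g\<close> is separated from its non-neighbours.\<close>

lemma C4_partition_if_locally_split:
  assumes inV: "\<And>x y. R x y \<Longrightarrow> x \<in> V \<and> y \<in> V"
    and irr: "\<And>x. \<not> R x x"
    and gf: "R g f" and split: "locally_split V R g f"
  shows "C4_partition V R"
proof -
  define S where "S = {x. R g x \<and> (x = f \<or> R f x)}"
  obtain h j where h: "h \<in> V" "h \<noteq> g" "\<not> R g h" and j: "R g j" "j \<noteq> f" "\<not> R f j"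
    using split unfolding locally_split_def by blast
  have "f \<in> S" "j \<in> Collect (R g) - S" "h \<in> V - insert g (Collect (R g))"
    using gf h j by (auto simp: S_def)
  moreover have "\<not> R x y" if "x \<in> S" "y \<in> Collect (R g) - S" for x y
    using split inV that unfolding locally_split_def S_def by blast
  moreover have "S \<subseteq> Collect (R g)"
    by (auto simp: S_def)
  ultimately show ?thesis
    using inV irr gf
    by (intro C4_partitionI[of "{g}" S "V - insert g (Collect (R g))" "Collect (R g) - S"]) blast+
qed

section \<open>Necessity, via the root graph\<close>

text \<open>The map \<open>r\<close> sends a vertex of the line graph to its edge of the root graph.
  The parts become labels of root vertices, to which \<open>labelled_edge\<close> applies. The
  conclusion covers every neighbour \<open>f\<close> because the program tests only the first one it
  lists.\<close>

lemma locally_split_if_C4_partition: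
  fixes r :: "'b \<Rightarrow> 'a set"
  assumes R: "\<And>i j. R i j \<longleftrightarrow> i \<in> V \<and> j \<in> V \<and> r i \<noteq> r j \<and> r i \<inter> r j \<noteq> {}"
    and inj: "inj_on r V"
    and edge: "\<And>i. i \<in> V \<Longrightarrow> \<exists>u v. u \<noteq> v \<and> r i = {u, v}"
    and near: "\<And>a b. a \<in> V \<Longrightarrow> b \<in> V \<Longrightarrow> \<not> far_apart V R a b"
    and part: "C4_partition V R"
  shows "\<exists>g\<in>V. (\<exists>f. R g f) \<and> (\<forall>f. R g f \<longrightarrow> locally_split V R g f)"
proof -
  define adj where "adj x y \<longleftrightarrow> {x, y} \<in> r ` V" for x y
  have sym: "adj x y \<Longrightarrow> adj y x" for x y
    by (simp add: adj_def insert_commute)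
  have adjE: "\<exists>i\<in>V. r i = {x, y}" if "adj x y" for x y
    using that unfolding adj_def by (metis imageE)
  have irr: "adj x y \<Longrightarrow> x \<noteq> y" for x y
    using edge by (fastforce simp: adj_def doubleton_eq_iff)
  obtain V1 V2 V3 V4 where
    ne: "V1 \<noteq> {}" "V2 \<noteq> {}" "V3 \<noteq> {}" "V4 \<noteq> {}" and
    dj: "V1 \<inter> V3 = {}" "V2 \<inter> V4 = {}" and
    un: "V1 \<union> V2 \<union> V3 \<union> V4 = V" and
    ac: "\<And>i j. i \<in> V1 \<Longrightarrow> j \<in> V3 \<Longrightarrow> \<not> R i j" "\<And>i j. i \<in> V2 \<Longrightarrow> j \<in> V4 \<Longrightarrow> \<not> R i j"
    using part unfolding C4_partition_def by (elim exE conjE) (rule that, auto)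
  have disj13: "r i \<inter> r j = {}" if "i \<in> V1" "j \<in> V3" for i j
  proof -
    have "i \<in> V" "j \<in> V" "i \<noteq> j"
      using that un dj by auto
    then show ?thesis
      using ac(1)[OF that] R inj by (auto dest: inj_onD)
  qed
  have disj24: "r i \<inter> r j = {}" if "i \<in> V2" "j \<in> V4" for i j
  proof -
    have "i \<in> V" "j \<in> V" "i \<noteq> j"
      using that un dj by auto
    then show ?thesis
      using ac(2)[OF that] R inj by (auto dest: inj_onD)
  qed
  \<comment> \<open>A root vertex meeting neither \<open>V1\<close> nor \<open>V3\<close> gets
    \<open>\<not> p\<close> by default, and similarly for \<open>q\<close>. This is harmless, since
    only \<open>col\<close> is used afterwards.\<close>
  define p where "p x \<longleftrightarrow> (\<exists>i\<in>V1. x \<in> r i)" for x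
  define q where "q x \<longleftrightarrow> (\<exists>i\<in>V2. x \<in> r i)" for x
  have col: "i \<in> V1 \<Longrightarrow> x \<in> r i \<Longrightarrow> p x" "i \<in> V2 \<Longrightarrow> x \<in> r i \<Longrightarrow> q x"
    "i \<in> V3 \<Longrightarrow> x \<in> r i \<Longrightarrow> \<not> p x" "i \<in> V4 \<Longrightarrow> x \<in> r i \<Longrightarrow> \<not> q x" for i x
    using disj13 disj24 unfolding p_def q_def by blast+
  have lab: "p x = p y \<or> q x = q y" if xy: "adj x y" for x y
  proof -
    obtain i where "i \<in> V" "r i = {x, y}"
      using adjE[OF xy] by blast
    then show ?thesis
      using un col by (metis UnE insert_iff)
  qed
  have edge_in: "\<exists>x y. adj x y \<and> r i = {x, y}" if "i \<in> V" for i
    using edge[OF that] that by (auto simp: adj_def intro: rev_image_eqI)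
  obtain x1 y1 where e1: "adj x1 y1" "p x1" "p y1"
    using ne(1) un edge_in col(1) by (metis UnCI all_not_in_conv insert_iff)
  obtain x2 y2 where e2: "adj x2 y2" "q x2" "q y2"
    using ne(2) un edge_in col(2) by (metis UnCI all_not_in_conv insert_iff)
  obtain x3 y3 where e3: "adj x3 y3" "\<not> p x3" "\<not> p y3"
    using ne(3) un edge_in col(3) by (metis UnCI all_not_in_conv insert_iff)
  obtain x4 y4 where e4: "adj x4 y4" "\<not> q x4" "\<not> q y4"
    using ne(4) un edge_in col(4) by (metis UnCI all_not_in_conv insert_iff)
  have join: "adj x u \<or> adj x v \<or> adj y u \<or> adj y v"
    if a: "adj x y" "adj u v" and disj: "{x, y} \<inter> {u, v} = {}" for x y u v
  proof -
    obtain i j where ij: "i \<in> V" "j \<in> V" "r i = {x, y}" "r j = {u, v}"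
      using adjE[OF a(1)] adjE[OF a(2)] by blast
    then have "i \<noteq> j" "\<not> R i j"
      using disj by (auto simp: R)
    \<comment> \<open>The middle edge \<open>g\<close> meets two disjoint edges, so it has one end
      in each.\<close>
    then obtain g where g: "g \<in> V" "R g i" "R g j"
      using near[OF ij(1,2)] unfolding far_apart_def by blast
    obtain z w where "r g = {z, w}" "adj z w"
      using edge_in[OF g(1)] by blast
    then show ?thesis
      using g(2,3) ij disj sym by (auto simp: R)
  qed
  \<comment> \<open>An edge supplied by \<open>join\<close> would connect opposite classes, against
    \<open>lab\<close>.\<close>
  have no_edges_12_34: "\<not> (adj x y \<and> p x \<and> q x \<and> p y \<and> q y \<and> adj u v \<and> \<not> p u \<and> \<not> q u \<and> \<not> p v \<and> \<not> q v)" for x y u v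
    using join[of x y u v] lab[of x u] lab[of x v] lab[of y u] lab[of y v] by auto
  have no_edges_14_23: "\<not> (adj x y \<and> p x \<and> \<not> q x \<and> p y \<and> \<not> q y \<and> adj u v \<and> \<not> p u \<and> q u \<and> \<not> p v \<and> q v)" for x y u v
    using join[of x y u v] lab[of x u] lab[of x v] lab[of y u] lab[of y v] by auto
  \<comment> \<open>In each pair of opposite classes one is independent. One class from each pair
    makes two consecutive classes, which share exactly one label.\<close>
  consider
      (nq) "\<And>x y. adj x y \<Longrightarrow> \<not> q x \<Longrightarrow> \<not> q y \<Longrightarrow> p x \<noteq> p y"
    | (q) "\<And>x y. adj x y \<Longrightarrow> q x \<Longrightarrow> q y \<Longrightarrow> p x \<noteq> p y"
    | (np) "\<And>x y. adj x y \<Longrightarrow> \<not> p x \<Longrightarrow> \<not> p y \<Longrightarrow> q x \<noteq> q y"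
    | (p) "\<And>x y. adj x y \<Longrightarrow> p x \<Longrightarrow> p y \<Longrightarrow> q x \<noteq> q y"
    using no_edges_12_34 no_edges_14_23 by metis
  then have "\<exists>c d a b x y. adj c d \<and> adj a d \<and> a \<noteq> c \<and> adj b c \<and> b \<noteq> d \<and>
    adj x y \<and> {x, y} \<inter> {c, d} = {} \<and> (\<forall>z. \<not> (adj c z \<and> adj d z))"
  proof cases
    case nq
    show ?thesis
      by (rule labelled_edge[of adj p q, OF sym lab nq join e1 e2 e3 e4])
  next
    \<comment> \<open>The remaining cases reduce to the first by negating a label or exchanging
      \<open>p\<close> and \<open>q\<close>, with the four monochromatic edges permuted
      accordingly.\<close>
    case q
    show ?thesis
      by (rule labelled_edge[of adj p "\<lambda>x. \<not> q x", OF sym _ _ join e1 e4 e3 e2(1)])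
        (use e2 lab q in blast)+
  next
    case np
    show ?thesis
      by (rule labelled_edge[of adj q p, OF sym _ np join e2 e1 e4 e3]) (use lab in blast)+
  next
    case p
    show ?thesis
      by (rule labelled_edge[of adj q "\<lambda>x. \<not> p x", OF sym _ _ join e2 e3 e4 e1(1)])
        (use e1 lab p in blast)+
  qed
  then obtain c d a b x y where cd: "adj c d" and ad: "adj a d" "a \<noteq> c" and bc: "adj b c" "b \<noteq> d"
    and xy: "adj x y" "{x, y} \<inter> {c, d} = {}" and tri: "\<And>z. \<not> (adj c z \<and> adj d z)"
    by (elim exE conjE) (rule that, auto)
  obtain g ga gb h where g: "g \<in> V" "r g = {c, d}" and ga: "ga \<in> V" "r ga = {a, d}"
    and gb: "gb \<in> V" "r gb = {b, c}" and h: "h \<in> V" "r h = {x, y}"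
    using adjE[OF cd] adjE[OF ad(1)] adjE[OF bc(1)] adjE[OF xy(1)] by metis
  have "c \<noteq> d" "a \<noteq> d" "b \<noteq> c"
    using cd ad bc irr by auto
  have gh: "h \<noteq> g" "\<not> R g h"
    using g h xy by (auto simp: R)
  \<comment> \<open>The neighbours of \<open>cd\<close> are the other edges at \<open>c\<close> and
    at \<open>d\<close>: the two cliques. Edges \<open>cz\<close> and \<open>dw\<close> from
    different cliques could meet only in \<open>z = w\<close>, a triangle, which \<open>tri'\<close>
    excludes.\<close>
  have Rg: "R g i \<longleftrightarrow> (\<exists>z. i \<in> V \<and> r i = {c, z} \<and> z \<noteq> d \<and> z \<noteq> c) \<or>
      (\<exists>z. i \<in> V \<and> r i = {d, z} \<and> z \<noteq> c \<and> z \<noteq> d)" for i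
    using edge[of i] \<open>c \<noteq> d\<close> g unfolding R by (auto simp: doubleton_eq_iff insert_commute)
  have tri': False if "i \<in> V" "j \<in> V" "r i = {c, z}" "r j = {d, z}" for i j z
    using tri[of z] that by (auto simp: adj_def intro: rev_image_eqI)
  have Rg_ab: "R g ga" "R g gb"
    using g ga gb ad bc \<open>c \<noteq> d\<close> by (auto simp: R doubleton_eq_iff)
  have split: "locally_split V R g f" if f: "R g f" for f
    using f[unfolded Rg]
  proof (elim disjE exE conjE)
    fix z assume z: "f \<in> V" "r f = {c, z}" "z \<noteq> d" "z \<noteq> c"
    \<comment> \<open>Otherwise \<open>a\<close>, \<open>c\<close>, \<open>d\<close> form a
      triangle. Hence \<open>ga\<close> witnesses a neighbour of \<open>g\<close> on the side away
      from \<open>f\<close>.\<close>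
    have "a \<noteq> z"
      using tri'[of f ga z] z(1,2) ga by (metis insert_commute)
    then have "r f \<inter> r ga = {}"
      using z ga ad(2) \<open>c \<noteq> d\<close> by auto
    then have ga_f: "ga \<noteq> f" "\<not> R f ga"
      using z(2) by (auto simp: R)
    have side: "\<exists>w. r i = {c, w} \<and> w \<noteq> d" if i: "R g i" "i = f \<or> R f i" for i
    proof (rule ccontr)
      assume n: "\<nexists>w. r i = {c, w} \<and> w \<noteq> d"
      then obtain w where "i \<in> V" "r i = {d, w}" "w \<noteq> c"
        using i(1) unfolding Rg by blast
      moreover have "R f i"
        using n i(2) z by auto
      ultimately show False
        using z \<open>c \<noteq> d\<close> tri'[of f i z] by (auto simp: R)
    qed
    have side': "\<exists>w. r j = {d, w} \<and> w \<noteq> c" if j: "R g j" "j \<noteq> f" "\<not> R f j" for j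
    proof (rule ccontr)
      assume "\<nexists>w. r j = {d, w} \<and> w \<noteq> c"
      then obtain w where w: "j \<in> V" "r j = {c, w}"
        using j(1) unfolding Rg by blast
      then have "r j \<noteq> r f"
        using j(2) z(1) inj by (auto dest: inj_onD)
      then show False
        using j(3) z(1,2) w by (auto simp: R)
    qed
    have cross: "\<not> R i j" if "r i = {c, v}" "v \<noteq> d" "r j = {d, w}" "w \<noteq> c" for i j v w
      using that \<open>c \<noteq> d\<close> tri'[of i j v] by (auto simp: R)
    show ?thesis
      unfolding locally_split_def
    proof (intro conjI ballI impI)
      show "\<exists>h\<in>V. h \<noteq> g \<and> \<not> R g h"
        using gh h(1) by blast
      show "\<exists>j\<in>V. R g j \<and> j \<noteq> f \<and> \<not> R f j"
        using Rg_ab(1) ga_f ga(1) by blast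
      show "\<not> R i j" if "R g i" "R g j" "i = f \<or> R f i" "j \<noteq> f" "\<not> R f j" for i j
        using side[OF that(1,3)] side'[OF that(2,4,5)] cross by blast
    qed
  next
    \<comment> \<open>The same argument with \<open>c\<close> and \<open>d\<close> exchanged and
      \<open>gb\<close> in place of \<open>ga\<close>.\<close>
    fix z assume z: "f \<in> V" "r f = {d, z}" "z \<noteq> c" "z \<noteq> d"
    have "b \<noteq> z"
      using tri'[of gb f z] z(1,2) gb by (metis insert_commute)
    then have "r f \<inter> r gb = {}"
      using z gb bc(2) \<open>c \<noteq> d\<close> by auto
    then have gb_f: "gb \<noteq> f" "\<not> R f gb"
      using z(2) by (auto simp: R)
    have side: "\<exists>w. r i = {d, w} \<and> w \<noteq> c" if i: "R g i" "i = f \<or> R f i" for i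
    proof (rule ccontr)
      assume n: "\<nexists>w. r i = {d, w} \<and> w \<noteq> c"
      then obtain w where "i \<in> V" "r i = {c, w}" "w \<noteq> d"
        using i(1) unfolding Rg by blast
      moreover have "R f i"
        using n i(2) z by auto
      ultimately show False
        using z \<open>c \<noteq> d\<close> tri'[of i f z] by (auto simp: R)
    qed
    have side': "\<exists>w. r j = {c, w} \<and> w \<noteq> d" if j: "R g j" "j \<noteq> f" "\<not> R f j" for j
    proof (rule ccontr)
      assume "\<nexists>w. r j = {c, w} \<and> w \<noteq> d"
      then obtain w where w: "j \<in> V" "r j = {d, w}"
        using j(1) unfolding Rg by blast
      then have "r j \<noteq> r f"
        using j(2) z(1) inj by (auto dest: inj_onD)
      then show False
        using j(3) z(1,2) w by (auto simp: R)
    qed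
    have cross: "\<not> R i j" if "r i = {d, v}" "v \<noteq> c" "r j = {c, w}" "w \<noteq> d" for i j v w
      using that \<open>c \<noteq> d\<close> tri'[of j i v] by (auto simp: R)
    show ?thesis
      unfolding locally_split_def
    proof (intro conjI ballI impI)
      show "\<exists>h\<in>V. h \<noteq> g \<and> \<not> R g h"
        using gh h(1) by blast
      show "\<exists>j\<in>V. R g j \<and> j \<noteq> f \<and> \<not> R f j"
        using Rg_ab(2) gb_f gb(1) by blast
      show "\<not> R i j" if "R g i" "R g j" "i = f \<or> R f i" "j \<noteq> f" "\<not> R f j" for i j
        using side[OF that(1,3)] side'[OF that(2,4,5)] cross by blast
    qed
  qed
  from Rg_ab split g(1) show ?thesis
    by blast
qed

section \<open>The algorithm\<close>

definition runs_within :: "nat \<Rightarrow> com \<Rightarrow> store \<Rightarrow> nat \<Rightarrow> (store \<Rightarrow> bool) \<Rightarrow> bool" where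
  "runs_within w P s T Q \<longleftrightarrow> (\<exists>t s'. run w P s t s' \<and> t \<le> T \<and> Q s')"

text \<open>Loop-free code is evaluated symbolically and timed by a static bound, so that only loops
  need invariants.\<close>

fun loop_free :: "com \<Rightarrow> bool" where
  "loop_free (Seq P Q) \<longleftrightarrow> loop_free P \<and> loop_free Q"
| "loop_free (Cond e P Q) \<longleftrightarrow> loop_free P \<and> loop_free Q"
| "loop_free (While e P) \<longleftrightarrow> False"
| "loop_free _ \<longleftrightarrow> True"

text \<open>The values of \<open>exec\<close> and \<open>max_time\<close> on loops are junk.\<close>

fun exec :: "nat \<Rightarrow> com \<Rightarrow> store \<Rightarrow> store" where
  "exec w Skip s = s"
| "exec w (Assign x e) s = s\<lparr>var := (var s)(x := eval w s e)\<rparr>"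
| "exec w (Store a i e) s = s\<lparr>cell := (cell s)(a := (cell s a)(eval w s i := eval w s e))\<rparr>"
| "exec w (Seq P Q) s = exec w Q (exec w P s)"
| "exec w (Cond e P Q) s = (if eval w s e \<noteq> 0 then exec w P s else exec w Q s)"
| "exec w (While e P) s = s"

fun max_time :: "com \<Rightarrow> nat" where
  "max_time Skip = 1"
| "max_time (Assign x e) = 1 + cost e"
| "max_time (Store a i e) = 1 + cost i + cost e"
| "max_time (Seq P Q) = max_time P + max_time Q"
| "max_time (Cond e P Q) = 1 + cost e + max (max_time P) (max_time Q)"
| "max_time (While e P) = 0"

lemma run_exec: "loop_free P \<Longrightarrow> \<exists>t. run w P s t (exec w P s) \<and> t \<le> max_time P"
proof (induction P arbitrary: s)
  case (Seq P Q)
  then obtain t u where "run w P s t (exec w P s)" "t \<le> max_time P"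
    "run w Q (exec w P s) u (exec w Q (exec w P s))" "u \<le> max_time Q"
    by fastforce
  then show ?case
    by (auto intro!: exI[of _ "t + u"] run_Seq)
next
  case (Cond e P Q)
  show ?case
  proof (cases "eval w s e = 0")
    case True
    obtain t where "run w Q s t (exec w Q s)" "t \<le> max_time Q"
      using Cond by fastforce
    with True show ?thesis
      by (auto intro!: exI[of _ "1 + cost e + t"] run_Cond_False simp del: add_Suc)
  next
    case False
    obtain t where "run w P s t (exec w P s)" "t \<le> max_time P"
      using Cond by fastforce
    with False show ?thesis
      by (auto intro!: exI[of _ "1 + cost e + t"] run_Cond_True simp del: add_Suc)
  qed
next
  case (Assign x e)
  show ?case
    using run_Assign[of w x e s] by auto
next
  case (Store a i e)
  show ?case
    using run_Store[of w a i e s] by auto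
qed (auto intro: run_Skip)

lemma runs_within_loop_free:
  "loop_free P \<Longrightarrow> max_time P \<le> T \<Longrightarrow> Q (exec w P s) \<Longrightarrow> runs_within w P s T Q"
  using run_exec[of P w s] by (fastforce simp: runs_within_def)

lemma runs_within_mono:
  "runs_within w P s T Q \<Longrightarrow> (\<And>s'. Q s' \<Longrightarrow> Q' s') \<Longrightarrow> runs_within w P s T Q'"
  by (auto simp: runs_within_def)

lemma runs_within_Seq:
  assumes "runs_within w P s T1 R" "\<And>s'. R s' \<Longrightarrow> runs_within w Q s' T2 S" "T1 + T2 \<le> T"
  shows "runs_within w (Seq P Q) s T S"
proof -
  obtain t1 s1 where 1: "run w P s t1 s1" "t1 \<le> T1" "R s1"
    using assms(1) by (auto simp: runs_within_def)
  then obtain t2 s2 where "run w Q s1 t2 s2" "t2 \<le> T2" "S s2"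
    using assms(2)[of s1] by (auto simp: runs_within_def)
  with 1 assms(3) show ?thesis
    unfolding runs_within_def by (intro exI[of _ "t1 + t2"] exI[of _ s2]) (auto intro: run_Seq)
qed

text \<open>The invariant is indexed by the number of completed iterations, of which there are
  exactly \<open>n\<close>. The extra \<open>1 + cost e\<close> pays for the final failing
  test.\<close>

lemma runs_within_While:
  assumes start: "I 0 s"
    and step: "\<And>k s. k < n \<Longrightarrow> I k s \<Longrightarrow> eval w s e \<noteq> 0 \<and> runs_within w P s B (I (Suc k))"
    and stop: "\<And>s. I n s \<Longrightarrow> eval w s e = 0 \<and> Q s"
    and time: "n * (1 + cost e + B) + 1 + cost e \<le> T"
  shows "runs_within w (While e P) s T Q"
proof -
  have "runs_within w (While e P) s (m * (1 + cost e + B) + 1 + cost e) Q" if "I k s" "k + m = n" for k m s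
    using that
  proof (induction m arbitrary: k s)
    case 0
    then show ?case
      using stop[of s] run_While_False[of w s e P] unfolding runs_within_def
      by (intro exI[of _ "1 + cost e"] exI[of _ s]) auto
  next
    case (Suc m)
    obtain t1 s1 where 1: "run w P s t1 s1" "t1 \<le> B" "I (Suc k) s1" "eval w s e \<noteq> 0"
      using step[of k s] Suc.prems by (auto simp: runs_within_def)
    then obtain t2 s2 where "run w (While e P) s1 t2 s2" "t2 \<le> m * (1 + cost e + B) + 1 + cost e" "Q s2"
      using Suc.IH[of "Suc k" s1] Suc.prems by (auto simp: runs_within_def)
    with 1 show ?case
      unfolding runs_within_def
      using run_While_True[of w s e P t1 s1 t2 s2]
      by (intro exI[of _ "1 + cost e + t1 + t2"] exI[of _ s2]) (auto simp: algebra_simps)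
  qed
  from this[of 0 s n] start time show ?thesis
    by (auto simp: runs_within_def intro: le_trans)
qed

section \<open>The program text\<close>

text \<open>
  For each vertex \<open>g\<close>, its neighbours are listed in \<open>L[0], \<dots>, L[m - 1]\<close>, and \<open>M\<close> marks the pairs at
  distance at most \<open>2\<close> realised through \<open>g\<close>. The neighbour \<open>L[0]\<close> plays the role of \<open>f\<close> in
  \<open>locally_split\<close>: \<open>two\<close> records that some neighbour lies on the other side, and \<open>ok\<close> is cleared by an
  edge between the two sides or if \<open>g\<close> is dominating.
\<close>

definition entry :: "string \<Rightarrow> exp \<Rightarrow> exp \<Rightarrow> exp" where
  "entry a i j = Cell a (Plus (Times i (Var ''size'')) j)"

definition set_mark :: "exp \<Rightarrow> exp \<Rightarrow> com" where
  "set_mark i j = Store ''M'' (Plus (Times i (Var ''size'')) j) (Num 1)"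

definition incr :: "string \<Rightarrow> com" where
  "incr x = Assign x (Plus (Var x) (Num 1))"

definition list_body :: com where
  "list_body = Seq
     (Cond (entry ''adj'' (Var ''g'') (Var ''h''))
       (Seq (Store ''L'' (Var ''m'') (Var ''h'')) (Seq (incr ''m'') (set_mark (Var ''g'') (Var ''h''))))
       Skip)
     (incr ''h'')"

text \<open>The sum acts as a disjunction. Its second summand catches position 0, that is
  \<open>f\<close> itself, which is not its own neighbour in a loop-free graph.\<close>

definition on_first_side :: "string \<Rightarrow> exp" where
  "on_first_side x =
     Plus (entry ''adj'' (Cell ''L'' (Num 0)) (Cell ''L'' (Var x))) (Less (Var x) (Num 1))"

definition pair_body :: com where
  "pair_body = Seq (set_mark (Cell ''L'' (Var ''i'')) (Cell ''L'' (Var ''j'')))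
     (Seq
       (Cond (on_first_side ''j'') Skip
         (Seq (Assign ''two'' (Num 1))
           (Cond (on_first_side ''i'')
             (Cond (entry ''adj'' (Cell ''L'' (Var ''i'')) (Cell ''L'' (Var ''j'')))
               (Assign ''ok'' (Num 0)) Skip)
             Skip)))
       (incr ''j''))"

definition vertex_init :: com where
  "vertex_init = Seq (set_mark (Var ''g'') (Var ''g'')) (Seq (Assign ''m'' (Num 0)) (Assign ''h'' (Num 0)))"

text \<open>The initial value of \<open>ok\<close> says that \<open>g\<close> and its
  \<open>m\<close> neighbours do not exhaust the vertices, so \<open>g\<close> is not
  dominating.\<close>

definition pairs_init :: com where
  "pairs_init = Seq (Assign ''ok'' (Less (Plus (Var ''m'') (Num 1)) (Var ''size'')))
     (Seq (Assign ''two'' (Num 0)) (Assign ''i'' (Num 0)))"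

definition vertex_end :: com where
  "vertex_end = Seq (Cond (Var ''two'') (Cond (Var ''ok'') (Assign ''out'' (Num 1)) Skip) Skip) (incr ''g'')"

definition row_body :: com where
  "row_body = Seq (Assign ''j'' (Num 0))
     (Seq (While (Less (Var ''j'') (Var ''m'')) pair_body) (incr ''i''))"

definition vertex_body :: com where
  "vertex_body = Seq vertex_init (Seq (While (Less (Var ''h'') (Var ''size'')) list_body)
     (Seq pairs_init (Seq (While (Less (Var ''i'') (Var ''m'')) row_body) vertex_end)))"

text \<open>An unmarked cell is a pair at distance at least 3, which already forces the answer
  yes.\<close>

definition scan_body :: com where
  "scan_body = Seq (Cond (Cell ''M'' (Var ''p'')) Skip (Assign ''out'' (Num 1))) (incr ''p'')"

definition program :: com where
  "program = Seq (While (Less (Var ''g'') (Var ''size'')) vertex_body) (Seq (Assign ''p'' (Num 0))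
     (While (Less (Var ''p'') (Times (Var ''size'') (Var ''size''))) scan_body))"

section \<open>Invariants and running time of the loops\<close>

text \<open>Contents of the array \<open>M\<close> as a characteristic function; marking a pair
  becomes set insertion.\<close>

definition ind :: "nat set \<Rightarrow> nat \<Rightarrow> nat" where
  "ind S p = of_bool (p \<in> S)"

lemma ind_upd [simp]: "(ind S)(p := Suc 0) = ind (insert p S)"
  by (auto simp: ind_def)

lemma ind_eq_0 [simp]: "ind S p = 0 \<longleftrightarrow> p \<notin> S"
  by (simp add: ind_def)

text \<open>Execution is analysed for a relation with degrees at most \<open>D\<close>; line graphs
  enter later, with \<open>D = 2 * n\<close>. The bound \<open>word\<close> keeps matrix indices and
  counters from wrapping around.\<close>

locale program_run =
  fixes w N D :: nat and R :: "nat \<Rightarrow> nat \<Rightarrow> bool"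
  assumes word: "(N + 1) ^ 2 \<le> 2 ^ w" and pos: "0 < N"
    and less: "\<And>i j. R i j \<Longrightarrow> i < N \<and> j < N"
    and deg: "\<And>g. g < N \<Longrightarrow> length (filter (R g) [0..<N]) \<le> D"
begin

definition A :: "nat \<Rightarrow> nat" where
  "A k = of_bool (k < N * N \<and> R (k div N) (k mod N))"

definition frame :: "store \<Rightarrow> bool" where
  "frame s \<longleftrightarrow> var s ''size'' = N \<and> cell s ''adj'' = A"

lemma word_bound: "N * N + 2 * N + 1 \<le> 2 ^ w"
  using word by (simp add: power2_eq_square)

lemma small [simp]: "k \<le> N * N + 2 * N \<Longrightarrow> k mod 2 ^ w = k"
  using word_bound by simp

lemma small' [simp]: "k \<le> N \<Longrightarrow> k mod 2 ^ w = k"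
  by (rule small) simp

lemma one_mod [simp]: "Suc 0 mod 2 ^ w = Suc 0"
  using pos by (intro small') simp

lemma index_less: "i < N \<Longrightarrow> j < N \<Longrightarrow> i * N + j < N * N"
proof -
  assume "i < N" "j < N"
  then have "i * N + j < Suc i * N" by simp
  also have "\<dots> \<le> N * N" using \<open>i < N\<close> by (intro mult_right_mono) auto
  finally show ?thesis .
qed

lemma eval_index:
  assumes "var s ''size'' = N" "eval w s a < N" "eval w s b < N"
  shows "eval w s (Plus (Times a (Var ''size'')) b) = eval w s a * N + eval w s b"
  using index_less[OF assms(2,3)] assms(1) by simp

lemma eval_entry:
  assumes "frame s" "eval w s a < N" "eval w s b < N"
  shows "eval w s (entry ''adj'' a b) = of_bool (R (eval w s a) (eval w s b))"
proof -
  have "eval w s (entry ''adj'' a b) = A (eval w s a * N + eval w s b)"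
    using assms unfolding entry_def eval.simps(3) by (subst eval_index) (auto simp: frame_def)
  then show ?thesis
    using assms index_less[OF assms(2,3)] by (simp add: A_def)
qed

lemma w_pos [simp]: "0 < w"
  using one_mod by (cases w) auto

lemma exec_set_mark:
  assumes "frame s" "eval w s a < N" "eval w s b < N"
  shows "exec w (set_mark a b) s = s\<lparr>cell := (cell s)(''M'' :=
    (cell s ''M'')(eval w s a * N + eval w s b := Suc 0))\<rparr>"
  unfolding set_mark_def exec.simps(3) using assms
  by (subst eval_index) (auto simp: frame_def)

definition nbrs :: "nat \<Rightarrow> nat list" where
  "nbrs g = filter (R g) [0..<N]"

definition first_side :: "nat \<Rightarrow> nat \<Rightarrow> bool" where
  "first_side g j \<longleftrightarrow> j = 0 \<or> R (nbrs g ! 0) (nbrs g ! j)"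

definition bad_pair :: "nat \<Rightarrow> nat \<Rightarrow> nat \<Rightarrow> bool" where
  "bad_pair g i j \<longleftrightarrow> first_side g i \<and> \<not> first_side g j \<and> R (nbrs g ! i) (nbrs g ! j)"

definition holds_list :: "nat list \<Rightarrow> store \<Rightarrow> bool" where
  "holds_list xs s \<longleftrightarrow> var s ''m'' = length xs \<and> (\<forall>i<length xs. cell s ''L'' i = xs ! i)"

definition vertex_state :: "nat \<Rightarrow> bool \<Rightarrow> nat set \<Rightarrow> store \<Rightarrow> bool" where
  "vertex_state g res S s \<longleftrightarrow> frame s \<and> var s ''g'' = g \<and> var s ''out'' = of_bool res \<and>
     cell s ''M'' = ind S"

lemma nbrs_less: "i < length (nbrs g) \<Longrightarrow> nbrs g ! i < N"
  using nth_mem[of i "nbrs g"] by (auto simp: nbrs_def)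

lemma length_nbrs: "length (nbrs g) \<le> N"
  unfolding nbrs_def using length_filter_le[of "R g" "[0..<N]"] by simp

text \<open>The conditional mark is written as a union with a set that is empty unless
  \<open>R g k\<close>, so both branches extend the loop invariant in the same way.\<close>

lemma list_step:
  assumes st: "vertex_state g res S s" and L: "holds_list (filter (R g) [0..<k]) s"
    and h: "var s ''h'' = k" "k < N" "g < N"
  shows "vertex_state g res (S \<union> {g * N + x | x. x = k \<and> R g x}) (exec w list_body s)"
    and "holds_list (filter (R g) [0..<Suc k]) (exec w list_body s)"
    and "var (exec w list_body s) ''h'' = Suc k"
proof -
  have fr: "frame s"
    using st by (simp add: vertex_state_def)
  have e: "eval w s (entry ''adj'' (Var ''g'') (Var ''h'')) = of_bool (R g k)"
    using st h by (subst eval_entry) (auto simp: vertex_state_def)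
  \<comment> \<open>Bounds \<open>m\<close> by \<open>k < N\<close>, so that incrementing it does
    not wrap.\<close>
  have len: "length (filter (R g) [0..<k]) \<le> k"
    using length_filter_le[of "R g" "[0..<k]"] by simp
  define s' where "s' = (if R g k then
     s\<lparr>var := (var s)(''m'' := Suc (var s ''m''), ''h'' := Suc k),
       cell := (cell s)(''L'' := (cell s ''L'')(var s ''m'' := k),
         ''M'' := ind (insert (g * N + k) S))\<rparr>
     else s\<lparr>var := (var s)(''h'' := Suc k)\<rparr>)"
  have "exec w list_body s = s'"
  proof (cases "R g k")
    case True
    then show ?thesis
      using e st h len L
      by (simp add: list_body_def incr_def s'_def vertex_state_def holds_list_def exec_set_mark
          frame_def fun_upd_twist)
  next
    case False
    then show ?thesis
      using e h by (simp add: list_body_def s'_def incr_def)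
  qed
  then show "vertex_state g res (S \<union> {g * N + x | x. x = k \<and> R g x}) (exec w list_body s)"
    "holds_list (filter (R g) [0..<Suc k]) (exec w list_body s)"
    "var (exec w list_body s) ''h'' = Suc k"
    using st L h by (auto simp: vertex_state_def holds_list_def frame_def s'_def nth_append less_Suc_eq)
qed

lemma eval_on_first_side:
  assumes "frame s" "holds_list (nbrs g) s" "var s x = i" "i < length (nbrs g)"
  shows "eval w s (on_first_side x) = 0 \<longleftrightarrow> \<not> first_side g i"
proof -
  have "0 < length (nbrs g)"
    using assms(4) by linarith
  then have "cell s ''L'' 0 = nbrs g ! 0" "cell s ''L'' i = nbrs g ! i"
    using assms by (auto simp: holds_list_def)
  moreover have "nbrs g ! 0 < N" "nbrs g ! i < N"
    using \<open>0 < length (nbrs g)\<close> assms(4) nbrs_less[of _ g] by auto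
  \<comment> \<open>The locale does not exclude loops of \<open>R\<close>, so both summands may be
    1; their sum must not wrap to 0.\<close>
  moreover have "(2 :: nat) mod 2 ^ w = 2"
    using pos by (intro small) simp
  ultimately show ?thesis
    using assms unfolding on_first_side_def eval.simps(4)
    by (subst eval_entry) (auto simp: first_side_def)
qed

lemma pair_step:
  assumes st: "vertex_state g res S s" and L: "holds_list (nbrs g) s"
    and i: "var s ''i'' = i" "i < length (nbrs g)" and j: "var s ''j'' = j" "j < length (nbrs g)"
    and flags: "var s ''two'' = of_bool tw" "var s ''ok'' = of_bool ok"
  defines "s' \<equiv> exec w pair_body s"
  shows "vertex_state g res (insert (nbrs g ! i * N + nbrs g ! j) S) s' \<and> holds_list (nbrs g) s' \<and>
    var s' ''i'' = i \<and> var s' ''j'' = Suc j \<and>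
    var s' ''two'' = of_bool (tw \<or> \<not> first_side g j) \<and>
    var s' ''ok'' = of_bool (ok \<and> \<not> bad_pair g i j)"
proof -
  have fr: "frame s"
    using st by (simp add: vertex_state_def)
  have Li: "cell s ''L'' i = nbrs g ! i" "cell s ''L'' j = nbrs g ! j"
    using L i j by (auto simp: holds_list_def)
  have lt: "nbrs g ! i < N" "nbrs g ! j < N" "Suc j \<le> N"
    using i j nbrs_less[of _ g] length_nbrs[of g] by auto
  define s1 where "s1 = exec w (set_mark (Cell ''L'' (Var ''i'')) (Cell ''L'' (Var ''j''))) s"
  have s1: "s1 = s\<lparr>cell := (cell s)(''M'' := ind (insert (nbrs g ! i * N + nbrs g ! j) S))\<rparr>"
    unfolding s1_def using fr Li lt i j st by (subst exec_set_mark) (auto simp: vertex_state_def)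
  have st1: "vertex_state g res (insert (nbrs g ! i * N + nbrs g ! j) S) s1"
    using st unfolding s1 by (auto simp: vertex_state_def frame_def)
  define s2 where "s2 = s1\<lparr>var := (var s1)(''two'' := Suc 0)\<rparr>"
  have fr': "frame s1" "frame s2"
    using fr by (auto simp: frame_def s1 s2_def)
  have L': "holds_list (nbrs g) s1" "holds_list (nbrs g) s2"
    using L by (auto simp: holds_list_def s1 s2_def)
  have e1: "eval w s1 (on_first_side ''j'') = 0 \<longleftrightarrow> \<not> first_side g j"
    by (rule eval_on_first_side) (use fr' L' j in \<open>auto simp: s1\<close>)
  have e2: "eval w s2 (on_first_side ''i'') = 0 \<longleftrightarrow> \<not> first_side g i"
    by (rule eval_on_first_side) (use fr' L' i in \<open>auto simp: s1 s2_def\<close>)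
  have e3: "eval w s2 (entry ''adj'' (Cell ''L'' (Var ''i'')) (Cell ''L'' (Var ''j''))) =
      of_bool (R (nbrs g ! i) (nbrs g ! j))"
    using fr' Li lt i j by (subst eval_entry) (auto simp: s1 s2_def)
  \<comment> \<open>The update of \<open>ok\<close> is stated unconditionally on the second side;
    for a pair that is not bad it rewrites the old value.\<close>
  have "s' = (if first_side g j then s1 else
      s2\<lparr>var := (var s2)(''ok'' := of_bool (ok \<and> \<not> bad_pair g i j))\<rparr>)
      \<lparr>var := (var (if first_side g j then s1 else
      s2\<lparr>var := (var s2)(''ok'' := of_bool (ok \<and> \<not> bad_pair g i j))\<rparr>))(''j'' := Suc j)\<rparr>"
    unfolding s'_def pair_body_def exec.simps(4) s1_def[symmetric]
    using e1 e2 e3 lt j flags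
    by (auto simp: s2_def[symmetric] incr_def bad_pair_def s1 s2_def fun_upd_idem)
  then show ?thesis
    using st1 L' i j flags
    by (auto simp: vertex_state_def frame_def holds_list_def s1 s2_def bad_pair_def)
qed

lemma row_runs:
  assumes st: "vertex_state g res S s" and L: "holds_list (nbrs g) s" and g: "g < N"
    and i: "var s ''i'' = i" "i < length (nbrs g)"
    and flags: "var s ''two'' = of_bool tw" "var s ''ok'' = of_bool ok"
  shows "runs_within w row_body s (104 * D + 20) (\<lambda>s.
    vertex_state g res (S \<union> {nbrs g ! i * N + nbrs g ! j | j. j < length (nbrs g)}) s \<and>
    holds_list (nbrs g) s \<and> var s ''i'' = Suc i \<and>
    var s ''two'' = of_bool (tw \<or> (\<exists>j<length (nbrs g). \<not> first_side g j)) \<and>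
    var s ''ok'' = of_bool (ok \<and> (\<forall>j<length (nbrs g). \<not> bad_pair g i j)))"
proof -
  let ?m = "length (nbrs g)"
  define I where "I k s \<longleftrightarrow>
    vertex_state g res (S \<union> {nbrs g ! i * N + nbrs g ! j | j. j < k}) s \<and>
    holds_list (nbrs g) s \<and> var s ''i'' = i \<and> var s ''j'' = k \<and>
    var s ''two'' = of_bool (tw \<or> (\<exists>j<k. \<not> first_side g j)) \<and>
    var s ''ok'' = of_bool (ok \<and> (\<forall>j<k. \<not> bad_pair g i j))" for k s
  have m: "?m \<le> D" "?m \<le> N"
    using deg[OF g] length_nbrs by (auto simp: nbrs_def)
  \<comment> \<open>The body costs at most 100 and the guard 4, whence the factor 104.\<close>
  have step: "eval w s (Less (Var ''j'') (Var ''m'')) \<noteq> 0 \<and> runs_within w pair_body s 100 (I (Suc k))"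
    if "k < ?m" "I k s" for k s
  proof
    show "eval w s (Less (Var ''j'') (Var ''m'')) \<noteq> 0"
      using that by (simp add: I_def holds_list_def)
    have S: "S \<union> {nbrs g ! i * N + nbrs g ! j | j. j < Suc k} =
        insert (nbrs g ! i * N + nbrs g ! k) (S \<union> {nbrs g ! i * N + nbrs g ! j | j. j < k})"
      by (auto simp: less_Suc_eq)
    have flags: "(tw \<or> (\<exists>j<k. \<not> first_side g j)) \<or> \<not> first_side g k \<longleftrightarrow>
        tw \<or> (\<exists>j<Suc k. \<not> first_side g j)"
      "(ok \<and> (\<forall>j<k. \<not> bad_pair g i j)) \<and> \<not> bad_pair g i k \<longleftrightarrow>
        ok \<and> (\<forall>j<Suc k. \<not> bad_pair g i j)"
      by (auto simp: less_Suc_eq)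
    note J = that(2)[unfolded I_def]
    note J1 = J[THEN conjunct1] and J2 = J[THEN conjunct2, THEN conjunct1]
      and J3 = J[THEN conjunct2, THEN conjunct2, THEN conjunct1]
      and J4 = J[THEN conjunct2, THEN conjunct2, THEN conjunct2, THEN conjunct1]
      and J5 = J[THEN conjunct2, THEN conjunct2, THEN conjunct2, THEN conjunct2, THEN conjunct1]
      and J6 = J[THEN conjunct2, THEN conjunct2, THEN conjunct2, THEN conjunct2, THEN conjunct2]
    have I: "I (Suc k) (exec w pair_body s)"
      unfolding I_def S using pair_step[OF J1 J2 J3 i(2) J4 that(1) J5 J6] unfolding flags .
    show "runs_within w pair_body s 100 (I (Suc k))"
      by (rule runs_within_loop_free[where Q = "I (Suc k)", OF _ _ I])
        (simp_all add: pair_body_def set_mark_def incr_def on_first_side_def entry_def)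
  qed
  have loop: "runs_within w (While (Less (Var ''j'') (Var ''m'')) pair_body) s (104 * D + 4) (I ?m)"
    if "I 0 s" for s
  proof (rule runs_within_While[where I = I and n = ?m, OF that step])
    show "eval w s (Less (Var ''j'') (Var ''m'')) = 0 \<and> I ?m s" if "I ?m s" for s
      using that by (simp add: I_def holds_list_def)
  qed (use m in simp_all)
  have start: "runs_within w (Assign ''j'' (Num 0)) s 2 (I 0)"
  proof (rule runs_within_loop_free)
    show "I 0 (exec w (Assign ''j'' (Num 0)) s)"
      using st L i flags by (simp add: I_def vertex_state_def frame_def holds_list_def)
  qed simp_all
  have finish: "runs_within w (incr ''i'') s 4 (\<lambda>s.
    vertex_state g res (S \<union> {nbrs g ! i * N + nbrs g ! j | j. j < length (nbrs g)}) s \<and>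
    holds_list (nbrs g) s \<and> var s ''i'' = Suc i \<and>
    var s ''two'' = of_bool (tw \<or> (\<exists>j<length (nbrs g). \<not> first_side g j)) \<and>
    var s ''ok'' = of_bool (ok \<and> (\<forall>j<length (nbrs g). \<not> bad_pair g i j)))" (is "runs_within _ _ _ _ ?Q")
    if "I ?m s" for s
  proof (rule runs_within_loop_free)
    show "?Q (exec w (incr ''i'') s)"
      using that i m by (simp add: incr_def I_def vertex_state_def frame_def holds_list_def)
  qed (simp_all add: incr_def)
  show ?thesis
    unfolding row_body_def
    by (rule runs_within_Seq[OF start], rule runs_within_Seq[OF loop finish], assumption, assumption,
        rule order_refl) simp
qed

text \<open>Encoded pairs at distance at most 2 seen from \<open>g\<close>, as an endpoint or as the
  middle vertex.\<close>

definition marks :: "nat \<Rightarrow> nat set" where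
  "marks g = {g * N + x | x. x = g \<or> R g x} \<union> {x * N + y | x y. R g x \<and> R g y}"

definition detected :: "nat \<Rightarrow> bool" where
  "detected g \<longleftrightarrow> length (nbrs g) + 1 < N \<and> (\<exists>j<length (nbrs g). \<not> first_side g j) \<and>
     (\<forall>i<length (nbrs g). \<forall>j<length (nbrs g). \<not> bad_pair g i j)"

text \<open>Regroups the marks in the order in which they are written: diagonal, list loop, pair
  loop.\<close>

lemma marks_eq:
  assumes "g < N"
  shows "marks g = insert (g * N + g) ({g * N + x | x. x < N \<and> R g x} \<union>
    {nbrs g ! i * N + nbrs g ! j | i j. i < length (nbrs g) \<and> j < length (nbrs g)})"
proof -
  have "(\<exists>i<length (nbrs g). nbrs g ! i = x) \<longleftrightarrow> x \<in> set (nbrs g)" for x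
    by (auto simp: in_set_conv_nth)
  also have "x \<in> set (nbrs g) \<longleftrightarrow> R g x" for x
    using less by (auto simp: nbrs_def)
  finally have "(\<exists>i<length (nbrs g). nbrs g ! i = x) \<longleftrightarrow> R g x" for x .
  then have mem: "R g x \<longleftrightarrow> (\<exists>i<length (nbrs g). nbrs g ! i = x)" for x
    by simp
  have "{nbrs g ! i * N + nbrs g ! j | i j. i < length (nbrs g) \<and> j < length (nbrs g)} =
      {x * N + y | x y. R g x \<and> R g y}"
    unfolding mem by (intro set_eqI iffI; elim CollectE exE conjE; blast)
  moreover have "{g * N + x | x. x = g \<or> R g x} = insert (g * N + g) {g * N + x | x. x < N \<and> R g x}"
    using less by (intro set_eqI iffI) auto
  ultimately show ?thesis
    by (simp add: marks_def)
qed

lemma vertex_runs: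
  assumes st: "vertex_state g res S s" and g: "g < N"
  shows "runs_within w vertex_body s (44 * N + (104 * D * D + 24 * D) + 100)
    (vertex_state (Suc g) (res \<or> detected g) (S \<union> marks g))"
proof -
  let ?m = "length (nbrs g)"
  have m: "?m \<le> D" "?m \<le> N"
    using deg[OF g] length_nbrs by (auto simp: nbrs_def)
  define S0 where "S0 = insert (g * N + g) S"
  define I where "I k s \<longleftrightarrow> vertex_state g res (S0 \<union> {g * N + x | x. x < k \<and> R g x}) s \<and>
    holds_list (filter (R g) [0..<k]) s \<and> var s ''h'' = k" for k s
  have 1: "runs_within w vertex_init s 20 (I 0)"
  proof (rule runs_within_loop_free)
    have "exec w vertex_init s = s\<lparr>var := (var s)(''m'' := 0, ''h'' := 0),
        cell := (cell s)(''M'' := ind S0)\<rparr>"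
      using st g by (simp add: vertex_init_def exec_set_mark vertex_state_def S0_def)
    then show "I 0 (exec w vertex_init s)"
      using st by (simp add: I_def vertex_state_def frame_def holds_list_def)
  qed (simp_all add: vertex_init_def set_mark_def)
  have 2: "runs_within w (While (Less (Var ''h'') (Var ''size'')) list_body) s (44 * N + 4) (I N)"
    if "I 0 s" for s
  proof (rule runs_within_While[where I = I and n = N and B = 40, OF that])
    show "eval w s (Less (Var ''h'') (Var ''size'')) \<noteq> 0 \<and> runs_within w list_body s 40 (I (Suc k))"
      if "k < N" "I k s" for k s
    proof
      show "eval w s (Less (Var ''h'') (Var ''size'')) \<noteq> 0"
        using that by (simp add: I_def vertex_state_def frame_def)
      have S0: "S0 \<union> {g * N + x | x. x < Suc k \<and> R g x} =
          S0 \<union> {g * N + x | x. x < k \<and> R g x} \<union> {g * N + x | x. x = k \<and> R g x}"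
        by (auto simp: less_Suc_eq)
      have I: "I (Suc k) (exec w list_body s)"
        using list_step[of g res "S0 \<union> {g * N + x | x. x < k \<and> R g x}" s k] that g
        unfolding I_def S0 by blast
      show "runs_within w list_body s 40 (I (Suc k))"
        by (rule runs_within_loop_free[where Q = "I (Suc k)", OF _ _ I])
          (simp_all add: list_body_def set_mark_def incr_def entry_def)
    qed
  qed (simp_all add: I_def vertex_state_def frame_def)
  define S1 where "S1 = S0 \<union> {g * N + x | x. x < N \<and> R g x}"
  \<comment> \<open>Every row makes the same contribution to \<open>two\<close>; quantifying over
    \<open>i < k\<close> makes the flag false before the first row.\<close>
  define J where "J k s \<longleftrightarrow> vertex_state g res
      (S1 \<union> {nbrs g ! i * N + nbrs g ! j | i j. i < k \<and> j < ?m}) s \<and>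
    holds_list (nbrs g) s \<and> var s ''i'' = k \<and>
    var s ''two'' = of_bool (\<exists>i<k. \<exists>j<?m. \<not> first_side g j) \<and>
    var s ''ok'' = of_bool (?m + 1 < N \<and> (\<forall>i<k. \<forall>j<?m. \<not> bad_pair g i j))" for k s
  have 3: "runs_within w pairs_init s 20 (J 0)" if "I N s" for s
  proof (rule runs_within_loop_free)
    have "Suc ?m mod 2 ^ w = Suc ?m"
      using m pos by (intro small) simp
    then show "J 0 (exec w pairs_init s)"
      using that m
      by (simp add: J_def I_def S1_def[symmetric] pairs_init_def vertex_state_def frame_def
          holds_list_def nbrs_def[symmetric])
  qed (simp_all add: pairs_init_def)
  have 4: "runs_within w (While (Less (Var ''i'') (Var ''m'')) row_body) s
      (104 * D * D + 24 * D + 4) (J ?m)" if "J 0 s" for s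
  proof (rule runs_within_While[where I = J and n = ?m, OF that])
    show "eval w s (Less (Var ''i'') (Var ''m'')) \<noteq> 0 \<and>
        runs_within w row_body s (104 * D + 20) (J (Suc k))" if "k < ?m" "J k s" for k s
    proof
      show "eval w s (Less (Var ''i'') (Var ''m'')) \<noteq> 0"
        using that by (simp add: J_def holds_list_def)
      have S1: "S1 \<union> {nbrs g ! i * N + nbrs g ! j | i j. i < Suc k \<and> j < ?m} =
          S1 \<union> {nbrs g ! i * N + nbrs g ! j | i j. i < k \<and> j < ?m} \<union>
            {nbrs g ! k * N + nbrs g ! j | j. j < ?m}"
        by (auto simp: less_Suc_eq)
      note J = that(2)[unfolded J_def, THEN conjunct1] that(2)[unfolded J_def, THEN conjunct2, THEN conjunct1]
        that(2)[unfolded J_def, THEN conjunct2, THEN conjunct2]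
      note row = row_runs[OF J(1,2) g J(3)[THEN conjunct1] that(1)
        J(3)[THEN conjunct2, THEN conjunct1] J(3)[THEN conjunct2, THEN conjunct2]]
      show "runs_within w row_body s (104 * D + 20) (J (Suc k))"
      proof (rule runs_within_mono[OF row], elim conjE, unfold J_def S1, intro conjI)
        fix s
        assume two: "var s ''two'' = of_bool ((\<exists>i<k. \<exists>j<?m. \<not> first_side g j) \<or> (\<exists>j<?m. \<not> first_side g j))"
          and ok: "var s ''ok'' = of_bool ((?m + 1 < N \<and> (\<forall>i<k. \<forall>j<?m. \<not> bad_pair g i j)) \<and>
            (\<forall>j<?m. \<not> bad_pair g k j))"
        show "var s ''two'' = of_bool (\<exists>i<Suc k. \<exists>j<?m. \<not> first_side g j)"
          unfolding two by (rule arg_cong[of _ _ of_bool]) (auto simp: less_Suc_eq)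
        show "var s ''ok'' = of_bool (?m + 1 < N \<and> (\<forall>i<Suc k. \<forall>j<?m. \<not> bad_pair g i j))"
          unfolding ok by (rule arg_cong[of _ _ of_bool]) (auto simp: less_Suc_eq)
      qed
    qed
    have "?m * (104 * D + 24) \<le> D * (104 * D + 24)"
      using m by simp
    then show "?m * (1 + cost (Less (Var ''i'') (Var ''m'')) + (104 * D + 20)) + 1 +
        cost (Less (Var ''i'') (Var ''m'')) \<le> 104 * D * D + 24 * D + 4"
      by (simp add: algebra_simps)
  qed (simp_all add: J_def holds_list_def)
  have 5: "runs_within w vertex_end s 20
      (vertex_state (Suc g) (res \<or> detected g) (S \<union> marks g))" if "J ?m s" for s
  proof (rule runs_within_loop_free)
    have S1: "S1 \<union> {nbrs g ! i * N + nbrs g ! j | i j. i < ?m \<and> j < ?m} = S \<union> marks g"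
      unfolding marks_eq[OF g] S1_def S0_def by (simp add: Un_assoc)
    have two: "(\<exists>i<?m. \<exists>j<?m. \<not> first_side g j) \<longleftrightarrow> (\<exists>j<?m. \<not> first_side g j)"
      by auto
    have flags: "var s ''two'' \<noteq> 0 \<and> var s ''ok'' \<noteq> 0 \<longleftrightarrow> detected g"
      using that unfolding J_def two detected_def by simp blast
    show "vertex_state (Suc g) (res \<or> detected g) (S \<union> marks g) (exec w vertex_end s)"
      using that[unfolded J_def S1, THEN conjunct1] g flags
      by (cases "detected g") (auto simp: vertex_end_def incr_def vertex_state_def frame_def)
  qed (simp_all add: vertex_end_def incr_def)
  show ?thesis
    unfolding vertex_body_def
    by (rule runs_within_Seq[OF 1], rule runs_within_Seq[OF 2], assumption,
        rule runs_within_Seq[OF 3], assumption, rule runs_within_Seq[OF 4 5], assumption, assumption,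
        rule order_refl, rule order_refl, rule order_refl) simp
qed

text \<open>There are \<open>N\<close> rounds of order \<open>N + D * D\<close>, followed by a scan
  of \<open>N * N\<close> cells at 15 units each (body 9, guard 6).\<close>

lemma program_runs:
  assumes "frame s" "var s ''g'' = 0" "var s ''out'' = 0" "cell s ''M'' = (\<lambda>_. 0)"
  shows "runs_within w program s
    (N * (44 * N + (104 * D * D + 24 * D) + 104) + 15 * (N * N) + 12)
    (\<lambda>s. var s ''out'' = of_bool ((\<exists>g<N. detected g) \<or> (\<exists>p<N * N. \<forall>g<N. p \<notin> marks g)))"
proof -
  define I where "I k = vertex_state k (\<exists>g<k. detected g) (\<Union>g<k. marks g)" for k
  have 1: "runs_within w (While (Less (Var ''g'') (Var ''size'')) vertex_body) s
      (N * (44 * N + (104 * D * D + 24 * D) + 104) + 4) (I N)"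
  proof (rule runs_within_While[where I = I and n = N])
    show "I 0 s"
      using assms by (auto simp: I_def vertex_state_def ind_def)
    show "eval w s (Less (Var ''g'') (Var ''size'')) \<noteq> 0 \<and>
        runs_within w vertex_body s (44 * N + (104 * D * D + 24 * D) + 100) (I (Suc k))"
      if "k < N" "I k s" for k s
    proof
      show "eval w s (Less (Var ''g'') (Var ''size'')) \<noteq> 0"
        using that by (simp add: I_def vertex_state_def frame_def)
      have "(\<Union>g<Suc k. marks g) = (\<Union>g<k. marks g) \<union> marks k"
        "(\<exists>g<Suc k. detected g) \<longleftrightarrow> (\<exists>g<k. detected g) \<or> detected k"
        by (auto simp: less_Suc_eq)
      then show "runs_within w vertex_body s (44 * N + (104 * D * D + 24 * D) + 100) (I (Suc k))"
        using vertex_runs[OF that(2)[unfolded I_def] that(1)] by (simp only: I_def)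
    qed
  qed (simp_all add: I_def vertex_state_def frame_def)
  define J where "J k s \<longleftrightarrow> var (s :: store) ''size'' = N \<and> var s ''p'' = k \<and> cell s ''M'' = ind (\<Union>g<N. marks g) \<and>
    var s ''out'' = of_bool ((\<exists>g<N. detected g) \<or> (\<exists>p<k. \<forall>g<N. p \<notin> marks g))" for k s
  have 2: "runs_within w (Assign ''p'' (Num 0)) s 2 (J 0)" if "I N s" for s
  proof (rule runs_within_loop_free)
    show "J 0 (exec w (Assign ''p'' (Num 0)) s)"
      using that by (simp add: I_def J_def vertex_state_def frame_def)
  qed simp_all
  have 3: "runs_within w (While (Less (Var ''p'') (Times (Var ''size'') (Var ''size''))) scan_body) s
      (15 * (N * N) + 6)
      (\<lambda>s. var s ''out'' = of_bool ((\<exists>g<N. detected g) \<or> (\<exists>p<N * N. \<forall>g<N. p \<notin> marks g)))"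
    if "J 0 s" for s
  proof (rule runs_within_While[where I = J and n = "N * N" and B = 9, OF that])
    show "eval w s (Less (Var ''p'') (Times (Var ''size'') (Var ''size''))) \<noteq> 0 \<and>
        runs_within w scan_body s 9 (J (Suc k))" if "k < N * N" "J k s" for k s
    proof
      show "eval w s (Less (Var ''p'') (Times (Var ''size'') (Var ''size''))) \<noteq> 0"
        using that by (simp add: J_def)
      have p: "(\<exists>p<Suc k. \<forall>g<N. p \<notin> marks g) \<longleftrightarrow>
          (\<exists>p<k. \<forall>g<N. p \<notin> marks g) \<or> k \<notin> (\<Union>g<N. marks g)"
        by (auto simp: less_Suc_eq)
      have J: "J (Suc k) (exec w scan_body s)"
        using that unfolding J_def p
        by (cases "k \<in> (\<Union>g<N. marks g)") (simp_all add: scan_body_def incr_def del: UN_iff)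
      show "runs_within w scan_body s 9 (J (Suc k))"
        by (rule runs_within_loop_free[where Q = "J (Suc k)", OF _ _ J])
          (simp_all add: scan_body_def incr_def)
    qed
  qed (simp_all add: J_def)
  show ?thesis
    unfolding program_def by (rule runs_within_Seq[OF 1], rule runs_within_Seq[OF 2 3], assumption, assumption,
        rule order_refl) simp
qed

end

section \<open>Correctness and running time\<close>

lemma line_graph_root:
  assumes H: "pverts H = {..<N}" and iso: "digraph_iso (with_proj (line_graph G)) (with_proj H)"
  obtains r where "bij_betw r {..<N} (edges G)"
    and "\<And>i j. (i, j) \<in> parcs H \<longleftrightarrow> i < N \<and> j < N \<and> r i \<noteq> r j \<and> r i \<inter> r j \<noteq> {}"
proof -
  let ?L = "with_proj (line_graph G)"
  obtain f where f: "pre_digraph.digraph_isomorphism ?L f" and eq: "with_proj H = app_iso f ?L"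
    using iso unfolding digraph_iso_def by blast
  define \<phi> where "\<phi> = iso_verts f"
  have inj: "inj_on \<phi> (edges G)"
    using f by (simp add: pre_digraph.digraph_isomorphism_def \<phi>_def line_graph_def)
  have verts: "\<phi> ` edges G = {..<N}"
    using arg_cong[OF eq, of verts] H by (simp add: \<phi>_def line_graph_def)
  \<comment> \<open>Arcs on both sides are pairs with the standard projections, so the vertex map
    \<open>\<phi>\<close> determines the arc map.\<close>
  have ends: "iso_tail f = fst" "iso_head f = snd"
    using arg_cong[OF eq, of tail] arg_cong[OF eq, of head] by simp_all
  have "iso_arcs f (e, e') = (\<phi> e, \<phi> e')" if "(e, e') \<in> parcs (line_graph G)" for e e'
    using f that ends by (auto simp: pre_digraph.digraph_isomorphism_def \<phi>_def prod_eq_iff)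
  then have "iso_arcs f ` parcs (line_graph G) = (\<lambda>(e, e'). (\<phi> e, \<phi> e')) ` parcs (line_graph G)"
    by (intro image_cong) auto
  then have parcs: "parcs H = (\<lambda>(e, e'). (\<phi> e, \<phi> e')) ` parcs (line_graph G)"
    using arg_cong[OF eq, of arcs] by simp
  define r where "r = inv_into (edges G) \<phi>"
  have bij: "bij_betw r {..<N} (edges G)"
    unfolding r_def using inj verts by (intro bij_betw_inv_into) (simp add: bij_betw_def)
  have r: "r (\<phi> e) = e" if "e \<in> edges G" for e
    using that inj by (simp add: r_def)
  have r': "\<phi> (r i) = i" "r i \<in> edges G" if "i < N" for i
    using that verts by (auto simp: r_def f_inv_into_f inv_into_into)
  show thesis
  proof (rule that[OF bij])
    fix i j
    show "(i, j) \<in> parcs H \<longleftrightarrow> i < N \<and> j < N \<and> r i \<noteq> r j \<and> r i \<inter> r j \<noteq> {}" (is "?l \<longleftrightarrow> ?r")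
    proof
      assume ?l
      then obtain e e' where "(e, e') \<in> parcs (line_graph G)" "i = \<phi> e" "j = \<phi> e'"
        unfolding parcs by auto
      moreover from this have "i \<in> {..<N}" "j \<in> {..<N}"
        unfolding verts[symmetric] by (auto simp: line_graph_def)
      ultimately show ?r
        using r by (auto simp: line_graph_def)
    next
      assume ij: ?r
      then have "(r i, r j) \<in> parcs (line_graph G)"
        using r' by (simp add: line_graph_def)
      then have "(\<phi> (r i), \<phi> (r j)) \<in> parcs H"
        unfolding parcs by (rule rev_image_eqI) simp
      then show ?l
        using ij r' by simp
    qed
  qed
qed

lemma edgeE:
  assumes "pair_graph G" "e \<in> edges G"
  obtains u v where "u \<noteq> v" "e = {u, v}" "u \<in> pverts G" "v \<in> pverts G"
proof -
  interpret pair_graph G by (fact assms)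
  obtain u v where uv: "(u, v) \<in> parcs G" "e = {u, v}"
    using assms(2) by (auto simp: edges_def)
  moreover have "u \<noteq> v"
    using uv pair_no_loops by fastforce
  moreover have "u \<in> pverts G" "v \<in> pverts G"
    using uv in_arcsD1 in_arcsD2 by auto
  ultimately show thesis
    using that by blast
qed

lemma finite_pverts_pair_graph:
  assumes "pair_graph G"
  shows "finite (pverts G)"
proof -
  interpret pair_graph G by (fact assms)
  show ?thesis by simp
qed

lemma card_edges_le:
  assumes "pair_graph G"
  shows "card (edges G) \<le> card (pverts G) ^ 2"
proof -
  have "edges G \<subseteq> (\<lambda>(u, v). {u, v}) ` (pverts G \<times> pverts G)"
    by (rule subsetI, erule edgeE[OF assms]) auto
  then have "card (edges G) \<le> card (pverts G \<times> pverts G)"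
    using finite_pverts_pair_graph[OF assms] by (intro surj_card_le) auto
  then show ?thesis
    by (simp add: card_cartesian_product power2_eq_square)
qed

text \<open>Each edge meeting \<open>{c, d}\<close> is determined by which of \<open>c\<close>,
  \<open>d\<close> it contains and its other end. This is the degree bound behind the fourth
  power.\<close>

lemma card_edges_at_le:
  assumes G: "pair_graph G" and e: "e \<in> edges G"
  shows "card {f \<in> edges G. e \<inter> f \<noteq> {}} \<le> 2 * card (pverts G)"
proof -
  note fin = finite_pverts_pair_graph[OF G]
  obtain c d where cd: "e = {c, d}"
    using edgeE[OF G e] by metis
  have "{f \<in> edges G. e \<inter> f \<noteq> {}} \<subseteq> (\<lambda>x. {c, x}) ` pverts G \<union> (\<lambda>x. {d, x}) ` pverts G"
    unfolding cd by (rule subsetI, elim CollectE conjE, erule edgeE[OF G]) (auto simp: insert_commute)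
  then have "card {f \<in> edges G. e \<inter> f \<noteq> {}} \<le>
      card ((\<lambda>x. {c, x}) ` pverts G \<union> (\<lambda>x. {d, x}) ` pverts G)"
    using fin by (intro card_mono) auto
  also have "\<dots> \<le> card ((\<lambda>x. {c, x}) ` pverts G) + card ((\<lambda>x. {d, x}) ` pverts G)"
    by (rule card_Un_le)
  also have "\<dots> \<le> 2 * card (pverts G)"
    using card_image_le[OF fin, of "\<lambda>x. {c, x}"] card_image_le[OF fin, of "\<lambda>x. {d, x}"] by linarith
  finally show ?thesis .
qed

text \<open>The first arc of a walk from \<open>x\<close> to \<open>y\<close>; the second vertex
  rules out the one-vertex graph.\<close>

lemma has_neighbour_if_connected:
  assumes conn: "Digraph_Component.connected (with_proj H)" and sym: "sym (parcs H)"
    and xy: "x \<in> pverts H" "y \<in> pverts H" "x \<noteq> y"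
  shows "\<exists>z. (x, z) \<in> parcs H"
proof -
  have "mk_symmetric (with_proj H) = \<lparr> pverts = pverts H, parcs = parcs H \<rparr>"
    using sym by (force simp: mk_symmetric_def sym_def)
  then have "(x, y) \<in> rtrancl_on (pverts H) (parcs H)"
    using conn xy by (auto simp: Digraph_Component.connected_def strongly_connected_def reachable_def)
  then show ?thesis
    by (rule converse_rtrancl_on_cases) (use xy in auto)
qed

section \<open>Graph meaning of the flags and marks\<close>

context program_run
begin

lemma set_nbrs: "set (nbrs g) = {x. R g x}"
  using less by (auto simp: nbrs_def)

lemma nbrs_0: "nbrs g \<noteq> [] \<Longrightarrow> R g (nbrs g ! 0)"
  using set_nbrs nth_mem by blast

lemma first_side_iff:
  assumes "j < length (nbrs g)"
  shows "first_side g j \<longleftrightarrow> nbrs g ! j = nbrs g ! 0 \<or> R (nbrs g ! 0) (nbrs g ! j)"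
proof -
  have "distinct (nbrs g)"
    by (simp add: nbrs_def)
  then have "nbrs g ! j = nbrs g ! 0 \<longleftrightarrow> j = 0"
    using assms by (intro nth_eq_iff_index_eq) auto
  then show ?thesis
    by (simp add: first_side_def)
qed

text \<open>The program speaks of list positions, \<open>locally_split\<close> of vertices. Since
  \<open>nbrs g\<close> enumerates the neighbourhood without repetition, the three flag conditions
  translate one by one.\<close>

lemma detected_iff:
  assumes irr: "\<And>x. \<not> R x x" and g: "g < N"
  shows "detected g \<longleftrightarrow> nbrs g \<noteq> [] \<and> locally_split {..<N} R g (nbrs g ! 0)"
proof (cases "nbrs g = []")
  case True
  then show ?thesis by (simp add: detected_def)
next
  case False
  let ?f = "nbrs g ! 0"
  have all: "(\<forall>j<length (nbrs g). P (nbrs g ! j)) \<longleftrightarrow> (\<forall>x. R g x \<longrightarrow> P x)" for P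
    using set_nbrs[of g] by (metis all_set_conv_all_nth mem_Collect_eq)
  have ex: "(\<exists>j<length (nbrs g). P (nbrs g ! j)) \<longleftrightarrow> (\<exists>x. R g x \<and> P x)" for P
    using all[of "\<lambda>x. \<not> P x"] by blast
  have "length (nbrs g) = card {x. R g x}"
    using set_nbrs[of g] distinct_card[of "nbrs g"] by (simp add: nbrs_def)
  moreover have fin: "finite {x. R g x}"
    using set_nbrs[of g] by (metis finite_set)
  ultimately have card: "card (insert g {x. R g x}) = length (nbrs g) + 1"
    using irr by simp
  have sub: "insert g {x. R g x} \<subseteq> {..<N}"
    using g less by auto
  have "length (nbrs g) + 1 < N \<longleftrightarrow> insert g {x. R g x} \<noteq> {..<N}"
    using card card_subset_eq[OF finite_lessThan sub] card_mono[OF finite_lessThan sub]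
    by (metis card_lessThan le_neq_implies_less less_irrefl)
  also have "\<dots> \<longleftrightarrow> (\<exists>h\<in>{..<N}. h \<noteq> g \<and> \<not> R g h)"
    using sub by blast
  finally have 1: "length (nbrs g) + 1 < N \<longleftrightarrow> (\<exists>h\<in>{..<N}. h \<noteq> g \<and> \<not> R g h)" .
  have "(\<exists>j<length (nbrs g). \<not> first_side g j) \<longleftrightarrow>
      (\<exists>j<length (nbrs g). \<not> (nbrs g ! j = ?f \<or> R ?f (nbrs g ! j)))"
    using first_side_iff by blast
  also have "\<dots> \<longleftrightarrow> (\<exists>j\<in>{..<N}. R g j \<and> j \<noteq> ?f \<and> \<not> R ?f j)"
    unfolding ex[of "\<lambda>x. \<not> (x = ?f \<or> R ?f x)"] using less by blast
  finally have 2: "(\<exists>j<length (nbrs g). \<not> first_side g j) \<longleftrightarrow>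
      (\<exists>j\<in>{..<N}. R g j \<and> j \<noteq> ?f \<and> \<not> R ?f j)" .
  \<comment> \<open>\<open>Q\<close> restates the absence of a bad pair on vertices, in a form to
    which \<open>all\<close> applies twice.\<close>
  define Q where "Q x y \<longleftrightarrow> \<not> ((x = ?f \<or> R ?f x) \<and> \<not> (y = ?f \<or> R ?f y) \<and> R x y)" for x y
  have "(\<forall>i<length (nbrs g). \<forall>j<length (nbrs g). \<not> bad_pair g i j) \<longleftrightarrow>
      (\<forall>i<length (nbrs g). \<forall>j<length (nbrs g). Q (nbrs g ! i) (nbrs g ! j))"
    unfolding bad_pair_def Q_def using first_side_iff by blast
  also have "\<dots> \<longleftrightarrow> (\<forall>x. R g x \<longrightarrow> (\<forall>y. R g y \<longrightarrow> Q x y))"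
    unfolding all[of "Q x" for x] all[of "\<lambda>x. \<forall>y. R g y \<longrightarrow> Q x y"] ..
  also have "\<dots> \<longleftrightarrow> (\<forall>i\<in>{..<N}. \<forall>j\<in>{..<N}. R g i \<longrightarrow> R g j \<longrightarrow>
      i = ?f \<or> R ?f i \<longrightarrow> j \<noteq> ?f \<longrightarrow> \<not> R ?f j \<longrightarrow> \<not> R i j)"
    unfolding Q_def using less by blast
  finally show ?thesis
    unfolding detected_def locally_split_def 1 2 using False by simp
qed

lemma index_inj:
  assumes "a < N" "b < N" "c < N" "d < N"
  shows "a * N + b = c * N + d \<longleftrightarrow> a = c \<and> b = d"
proof
  assume eq: "a * N + b = c * N + d"
  have "a = (a * N + b) div N" "b = (a * N + b) mod N" "c = (c * N + d) div N" "d = (c * N + d) mod N"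
    using assms by auto
  with eq show "a = c \<and> b = d" by metis
qed simp

text \<open>Cell \<open>p\<close> stands for the pair \<open>(p div N, p mod N)\<close>. It stays
  unmarked exactly if its ends differ, are not adjacent and have no common neighbour.\<close>

lemma unmarked_iff:
  assumes sym: "\<And>x y. R x y \<Longrightarrow> R y x"
  shows "(\<exists>p<N * N. \<forall>g<N. p \<notin> marks g) \<longleftrightarrow> (\<exists>a<N. \<exists>b<N. far_apart {..<N} R a b)"
proof -
  have mark: "(\<forall>g<N. a * N + b \<notin> marks g) \<longleftrightarrow> far_apart {..<N} R a b" if "a < N" "b < N" for a b
  proof -
    have "a * N + b \<in> marks g \<longleftrightarrow> (a = g \<and> (b = g \<or> R g b)) \<or> (R g a \<and> R g b)" if "g < N" for g
    proof -
      have "(\<exists>x. a * N + b = g * N + x \<and> (x = g \<or> R g x)) \<longleftrightarrow> (a = g \<and> (b = g \<or> R g b))"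
        using index_inj \<open>a < N\<close> \<open>b < N\<close> \<open>g < N\<close> less by metis
      moreover have "(\<exists>x y. a * N + b = x * N + y \<and> R g x \<and> R g y) \<longleftrightarrow> R g a \<and> R g b"
        using index_inj \<open>a < N\<close> \<open>b < N\<close> less by metis
      ultimately show ?thesis
        by (simp add: marks_def)
    qed
    then show ?thesis
      using that unfolding far_apart_def by auto
  qed
  have "p < N * N \<Longrightarrow> p div N < N \<and> p mod N < N \<and> p = p div N * N + p mod N" for p
    using pos by (simp add: less_mult_imp_div_less)
  then show ?thesis
    using mark index_less by metis
qed

lemma program_correct:
  assumes R: "\<And>i j. R i j \<longleftrightarrow> i < N \<and> j < N \<and> r i \<noteq> r j \<and> r i \<inter> r j \<noteq> {}"
    and inj: "inj_on r {..<N}"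
    and edge: "\<And>i. i < N \<Longrightarrow> \<exists>u v. u \<noteq> v \<and> r i = {u, v}"
    and nbr: "\<And>x y. x < N \<Longrightarrow> y < N \<Longrightarrow> x \<noteq> y \<Longrightarrow> \<exists>z. R x z"
  shows "(\<exists>g<N. detected g) \<or> (\<exists>p<N * N. \<forall>g<N. p \<notin> marks g) \<longleftrightarrow> C4_partition {..<N} R"
proof -
  have sym: "R x y \<Longrightarrow> R y x" and irr: "\<not> R x x" and inV: "R x y \<Longrightarrow> x \<in> {..<N} \<and> y \<in> {..<N}" for x y
    by (auto simp: R)
  have "C4_partition {..<N} R"
    if "(\<exists>g<N. detected g) \<or> (\<exists>a<N. \<exists>b<N. far_apart {..<N} R a b)"
  proof -
    from that consider g where "g < N" "detected g" | a b where "a < N" "b < N" "far_apart {..<N} R a b"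
      by blast
    then show ?thesis
    proof cases
      case 1
      then show ?thesis
        using detected_iff[OF irr] nbrs_0 C4_partition_if_locally_split[of R "{..<N}", OF inV irr] by blast
    next
      case 2
      then have "a \<noteq> b"
        by (simp add: far_apart_def)
      \<comment> \<open>Every \<open>x\<close> differs from \<open>a\<close> or from
        \<open>b\<close>, which supplies the second vertex for \<open>nbr\<close>.\<close>
      then have "\<exists>y. R x y" if "x \<in> {..<N}" for x
        using that nbr 2(1,2) by (metis lessThan_iff)
      then show ?thesis
        using C4_partition_if_far_apart[of R "{..<N}" a b, OF sym inV irr] 2 by blast
    qed
  qed
  moreover have "(\<exists>g<N. detected g) \<or> (\<exists>a<N. \<exists>b<N. far_apart {..<N} R a b)"
    if part: "C4_partition {..<N} R"
  proof (cases "\<exists>a<N. \<exists>b<N. far_apart {..<N} R a b")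
    case False
    have "\<exists>g\<in>{..<N}. (\<exists>f. R g f) \<and> (\<forall>f. R g f \<longrightarrow> locally_split {..<N} R g f)"
      by (rule locally_split_if_C4_partition[of R "{..<N}" r, OF _ inj _ _ part])
        (use R edge False in auto)
    then obtain g f where g: "g < N" "R g f" "\<forall>f. R g f \<longrightarrow> locally_split {..<N} R g f"
      by blast
    then have "nbrs g \<noteq> []"
      using set_nbrs[of g] by force
    \<comment> \<open>The split holds for every neighbour of \<open>g\<close>, hence for the listed
      \<open>nbrs g ! 0\<close>.\<close>
    then have "detected g"
      using g detected_iff[OF irr g(1)] nbrs_0 by blast
    with g(1) show ?thesis by blast
  qed blast
  moreover have "(\<exists>p<N * N. \<forall>g<N. p \<notin> marks g) \<longleftrightarrow> (\<exists>a<N. \<exists>b<N. far_apart {..<N} R a b)"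
    by (rule unmarked_iff) (rule sym)
  ultimately show ?thesis
    by blast
qed

end

lemma has_disconnected_cut_iff_C4_partition:
  assumes "pair_graph H"
  shows "has_disconnected_cut (with_proj H) \<longleftrightarrow> C4_partition (pverts H) (\<lambda>i j. (i, j) \<in> parcs H)"
proof -
  have "A \<times> B \<inter> parcs H = {} \<longleftrightarrow> (\<forall>x\<in>A. \<forall>y\<in>B. (x, y) \<notin> parcs H)" for A B
    by blast
  then show ?thesis
    unfolding has_disconnected_cut_iff_partition[OF assms] C4_partition_def by simp
qed

text \<open>With degree bound \<open>2 * n\<close>, one round costs at most
  \<open>612 * n ^ 2\<close>, as \<open>44 + 416 + 48 + 104 = 612\<close>; the scan and the constant
  add at most \<open>27 * n ^ 4\<close> in total.\<close>

lemma time_bound: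
  fixes n N :: nat
  assumes "N \<le> n ^ 2" "0 < N"
  shows "N * (44 * N + (104 * (2 * n) * (2 * n) + 24 * (2 * n)) + 104) + 15 * (N * N) + 12 \<le> 700 * n ^ 4"
proof -
  let ?X = "n ^ 2"
  have X: "1 \<le> ?X"
    using assms by linarith
  then have "1 \<le> n"
    by (cases n) auto
  then have n: "n \<le> ?X"
    by (simp add: power2_eq_square)
  have "104 * (2 * n) * (2 * n) = 416 * ?X"
    by (simp add: power2_eq_square)
  then have "44 * N + (104 * (2 * n) * (2 * n) + 24 * (2 * n)) + 104 \<le> 612 * ?X"
    using n X assms(1) by linarith
  then have "N * (44 * N + (104 * (2 * n) * (2 * n) + 24 * (2 * n)) + 104) \<le> ?X * (612 * ?X)"
    using assms(1) by (rule mult_le_mono[rotated])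
  moreover have "N * N \<le> ?X * ?X"
    using assms(1) assms(1) by (rule mult_le_mono)
  moreover have "1 \<le> ?X * ?X"
    using mult_le_mono[OF X X] by simp
  ultimately have "N * (44 * N + (104 * (2 * n) * (2 * n) + 24 * (2 * n)) + 104) + 15 * (N * N) + 12 \<le>
      700 * (?X * ?X)"
    by linarith
  then show ?thesis
    by (simp add: power2_eq_square power4_eq_xxxx)
qed

lemma solves_program: "solves_disconnected_cut_on_line_graphs program 2 (\<lambda>n. 700 * n ^ 4)"
  unfolding solves_disconnected_cut_on_line_graphs_def
proof (intro allI impI, elim conjE)
  fix G H :: "nat pair_pre_digraph" and n N w :: nat
  assume G: "pair_graph G" and n: "card (pverts G) = n" and H: "pverts H = {..<N}"
    and iso: "digraph_iso (with_proj (line_graph G)) (with_proj H)"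
    and conn: "Digraph_Component.connected (with_proj H)" and word: "(N + 1) ^ 2 \<le> 2 ^ w"
  define R where "R i j \<longleftrightarrow> (i, j) \<in> parcs H" for i j
  obtain r where bij: "bij_betw r {..<N} (edges G)"
    and parcs: "\<And>i j. (i, j) \<in> parcs H \<longleftrightarrow> i < N \<and> j < N \<and> r i \<noteq> r j \<and> r i \<inter> r j \<noteq> {}"
    using line_graph_root[OF H iso] by metis
  have R: "R i j \<longleftrightarrow> i < N \<and> j < N \<and> r i \<noteq> r j \<and> r i \<inter> r j \<noteq> {}" for i j
    by (simp add: R_def parcs)
  have inj: "inj_on r {..<N}" and r: "\<And>i. i < N \<Longrightarrow> r i \<in> edges G"
    using bij by (auto simp: bij_betw_def)
  have sym: "sym (parcs H)"
    by (auto simp: sym_def parcs)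
  have "finite (parcs H)"
    by (rule finite_subset[of _ "{..<N} \<times> {..<N}"]) (auto simp: parcs)
  then have pgH: "pair_graph H"
    using sym by unfold_locales (auto simp: parcs H symmetric_def)
  \<comment> \<open>Library connectedness excludes the empty graph; this gives the locale assumption
    \<open>0 < N\<close>.\<close>
  have "pverts H \<noteq> {}"
    using conn by (simp add: Digraph_Component.connected_def strongly_connected_def mk_symmetric_def)
  then have N: "0 < N"
    using H by auto
  have "N = card (edges G)"
    using bij_betw_same_card[OF bij] by simp
  then have Nn: "N \<le> n ^ 2"
    using card_edges_le[OF G] n by simp
  have deg: "length (filter (R g) [0..<N]) \<le> 2 * n" if "g < N" for g
  proof -
    have "length (filter (R g) [0..<N]) = card {x. x < N \<and> R g x}"
      using distinct_card[of "filter (R g) [0..<N]"] by (simp add: conj_commute)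
    also have "\<dots> \<le> card {f \<in> edges G. r g \<inter> f \<noteq> {}}"
    proof (rule card_inj_on_le[of r])
      show "inj_on r {x. x < N \<and> R g x}"
        using inj by (rule inj_on_subset) auto
      show "r ` {x. x < N \<and> R g x} \<subseteq> {f \<in> edges G. r g \<inter> f \<noteq> {}}"
        using r by (auto simp: R)
      show "finite {f \<in> edges G. r g \<inter> f \<noteq> {}}"
        using bij_betw_finite[OF bij] by simp
    qed
    also have "\<dots> \<le> 2 * n"
      using card_edges_at_le[OF G r[OF that]] n by simp
    finally show ?thesis .
  qed
  interpret program_run w N "2 * n" R
  proof
    show "i < N \<and> j < N" if "R i j" for i j
      using that by (simp add: R)
  qed (fact word N deg)+
  have "A = (\<lambda>k. of_bool (k < N * N \<and> (k div N, k mod N) \<in> parcs H))"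
    by (rule ext) (simp add: A_def R_def)
  then have "frame (input H)" "var (input H) ''g'' = 0" "var (input H) ''out'' = 0"
    "cell (input H) ''M'' = (\<lambda>_. 0)"
    by (simp_all add: input_def frame_def H)
  from program_runs[OF this] obtain t s where run: "run w program (input H) t s"
    and t: "t \<le> N * (44 * N + (104 * (2 * n) * (2 * n) + 24 * (2 * n)) + 104) + 15 * (N * N) + 12"
    and out: "var s ''out'' = of_bool ((\<exists>g<N. detected g) \<or> (\<exists>p<N * N. \<forall>g<N. p \<notin> marks g))"
    unfolding runs_within_def by blast
  have edge: "\<exists>u v. u \<noteq> v \<and> r i = {u, v}" if "i < N" for i
    using edgeE[OF G r[OF that]] by metis
  have nbr: "\<exists>z. R x z" if "x < N" "y < N" "x \<noteq> y" for x y
    using has_neighbour_if_connected[OF conn sym, of x y] that by (simp add: H R_def)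
  have "C4_partition {..<N} R \<longleftrightarrow> has_disconnected_cut (with_proj H)"
    unfolding has_disconnected_cut_iff_C4_partition[OF pgH] H R_def[abs_def] ..
  moreover have "(\<exists>g<N. detected g) \<or> (\<exists>p<N * N. \<forall>g<N. p \<notin> marks g) \<longleftrightarrow> C4_partition {..<N} R"
    by (rule program_correct[OF _ inj]) (fact R edge nbr)+
  ultimately have "(\<exists>g<N. detected g) \<or> (\<exists>p<N * N. \<forall>g<N. p \<notin> marks g) \<longleftrightarrow>
      has_disconnected_cut (with_proj H)"
    by blast
  with out have "var s ''out'' = of_bool (has_disconnected_cut (with_proj H))"
    by (simp only:)
  then show "answers_within w program H (has_disconnected_cut (with_proj H)) (700 * n ^ 4)"
    unfolding answers_within_def using run order_trans[OF t time_bound[OF Nn N]] by blast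
qed

theorem theorem2:
  shows "\<exists>P d T. (\<lambda>n. real (T n)) \<in> O(\<lambda>n. real n ^ 4) \<and>
           solves_disconnected_cut_on_line_graphs P d T"
proof (intro exI conjI)
  show "(\<lambda>n. real (700 * n ^ 4)) \<in> O(\<lambda>n. real n ^ 4)"
    by simp
qed (rule solves_program)

end
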